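(* Let $(X,\rho)$ be an absolutely homogeneous (AB-HO) metric space and $\mathcal X$ be its skeleton. (A) Every layer-closed metric skeletoid is an edge-closed skeleton. (B) A Heine-Borel metric skeleton is layer-closed. More generally, if for some $r>0$ all closed balls in $X$ of radius $r$ are compact, then for any $n>0$ the set $D_{\mathcal X}^{(r)}(I_n)$ of all metrics from $D_{\mathcal X}(I_n)$ that are upper bounded by $r$ is closed in the set $D(I_n)$ of all metrics on $I_n$. (C) A layer-closed metric skeleton is complete. More generally, if $D_{\mathcal X}^{(r)}(I_n)$ is closed in $D(I_n)$ for any $n>0$ and some fixed $r>0$, then $(X,\rho)$ is a complete metric space. (D) $X$ is locally connected or locally hereditary disconnected. If $X$ is disconnected, all its connected components are bounded. (E) All connected components as well as arcwise-connected components of $X$ are AB-HO.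
   Context: A GEC (full graph with edge-coloring) is a pair $(V,\kappa)$ where $V$ is a set and $\kappa$ is a function on $V\times V$ such that for all $x,y,z\in V$: (GEC1) $\kappa(x,y)=\kappa(z,z)\iff x=y$; (GEC2) $\kappa(y,x)=\kappa(x,y)$. Metric spaces $(X,d)$ are GECs with $\kappa=d$. The palette is $\{\kappa(x,y):x\ne y\}$, the pseudocolor is the common value $\kappa(z,z)$ ($0$ for metric spaces), the size is the cardinality of $V$. Sub-GECs are restrictions to subsets. A partial morphism from $(V,\kappa)$ into $(W,\lambda)$ is a function $f\colon A\to W$, $A\subset V$, with $\kappa(a,b)=\lambda(f(a),f(b))$ for all $a,b\in A$; isomorphisms are bijective partial morphisms with $A=V$ (for metric spaces: surjective isometries); an automorphism is a self-isomorphism. A GEC (in particular a metric space) is absolutely homogeneous (AB-HO) if every partial morphism from it into itself extends to an automorphism; for a metric space this says that every isometric map from a subset of $X$ into $X$ extends to an isometry of $X$ onto $X$. A finitary structure is a class of finite non-empty GECs closed under taking non-empty sub-GECs and under isomorphic copies; it is proper if the colors of edges of its members form a set (its palette) and all members have the same pseudocolor. It satisfies MBP if for each color $c$ there is a finite bound for the sizes of its members all of whose edges have color $c$. An incomplete GEC is a quadruple $(V,a,b,\kappa)$, where $a\neq b$ are in $V$ and $\kappa$ is defined on $(V\times V)\setminus\{(a,b),(b,a)\}$ and satisfies (GEC1), (GEC2) there; it is affiliated with a class $\mathcal F$ if its restrictions to $V\setminus\{a\}$ and to $V\setminus\{b\}$ belong to $\mathcal F$; it is non-symmetric if $\kappa(a,c)\ne\kappa(b,c)$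 for some $c\in V\setminus\{a,b\}$. For such a $\mathfrak G=(V,a,b,\kappa)$, $\Delta_{\mathcal F}(\mathfrak G)$ is the set of all colors $c$ such that putting $\kappa(a,b)=\kappa(b,a)=c$ yields a GEC belonging to $\mathcal F$. $\mathcal F$ has AP if $\Delta_{\mathcal F}(\mathfrak G)\neq\varnothing$ for every non-symmetric incomplete GEC $\mathfrak G$ affiliated with $\mathcal F$. A skeletoid is a proper finitary structure satisfying MBP and having AP. The skeleton of an AB-HO GEC is the class of all (isomorphic copies of) its finite non-empty sub-GECs; a class is a skeleton if it is the skeleton of some AB-HO GEC, which is then unique up to isomorphism and is said to be generated by it. A skeletoid or skeleton is metric if it consists of metric spaces. A metric skeletoid $\mathcal F$ is edge-closed if $\Delta_{\mathcal F}(\mathfrak G)$ is a closed subset of $\mathbb R$ for each non-symmetric incomplete GEC $\mathfrak G$ affiliated with $\mathcal F$. With $I_n=\{1,\ldots,n\}$, $D(I_n)$ is the set of all metrics on $I_n$ with the pointwise convergence topology and $D_{\mathcal F}(I_n)$ is the set of all metrics $d$ on $I_n$ with $(I_n,d)\in\mathcal F$; $\mathcal F$ is layer-closed if $D_{\mathcal F}(I_n)$ is closed in $D(I_n)$ for all $n>1$. A metric space is Heine-Borel if all its closed balls are compact. A metric skeleton is called complete (Heine-Borel, etc.) if the AB-HO metric space it generates is complete (Heine-Borel, etc.). A topological space is hereditary disconnected if all its connected components are singletons; it is locally hereditary disconnected if it can be covered by open sets each of which is hereditary disconnected. *)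

theory Defs
  imports "HOL-Analysis.Analysis"
begin

text \<open>
  A GEC is a carrier set together with a colouring that is a total function on the ambient type;
  only the values on the carrier are ever used. Hence the sub-GEC of \<open>(V, k)\<close> on \<open>A \<subseteq> V\<close> is \<open>(A, k)\<close>.
\<close>

type_synonym ('v, 'c) gec = "'v set \<times> ('v \<Rightarrow> 'v \<Rightarrow> 'c)"

definition is_gec :: "'v set \<Rightarrow> ('v \<Rightarrow> 'v \<Rightarrow> 'c) \<Rightarrow> bool" where
  "is_gec V k \<longleftrightarrow>
     (\<forall>x\<in>V. \<forall>y\<in>V. \<forall>z\<in>V. k x y = k z z \<longleftrightarrow> x = y) \<and>
     (\<forall>x\<in>V. \<forall>y\<in>V. k y x = k x y)"

definition partial_morphism ::
  "'v set \<Rightarrow> ('v \<Rightarrow> 'v \<Rightarrow> 'c) \<Rightarrow> 'w set \<Rightarrow> ('w \<Rightarrow> 'w \<Rightarrow> 'c) \<Rightarrow> 'v set \<Rightarrow> ('v \<Rightarrow> 'w) \<Rightarrow> bool" where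
  "partial_morphism V k W l A f \<longleftrightarrow>
     A \<subseteq> V \<and> f ` A \<subseteq> W \<and> (\<forall>a\<in>A. \<forall>b\<in>A. k a b = l (f a) (f b))"

definition gec_iso ::
  "'v set \<Rightarrow> ('v \<Rightarrow> 'v \<Rightarrow> 'c) \<Rightarrow> 'w set \<Rightarrow> ('w \<Rightarrow> 'w \<Rightarrow> 'c) \<Rightarrow> ('v \<Rightarrow> 'w) \<Rightarrow> bool" where
  "gec_iso V k W l f \<longleftrightarrow> partial_morphism V k W l V f \<and> bij_betw f V W"

definition ab_ho :: "'v set \<Rightarrow> ('v \<Rightarrow> 'v \<Rightarrow> 'c) \<Rightarrow> bool" where
  "ab_ho V k \<longleftrightarrow> is_gec V k \<and>
     (\<forall>A f. partial_morphism V k V k A f \<longrightarrow>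
        (\<exists>g. gec_iso V k V k g \<and> (\<forall>a\<in>A. g a = f a)))"

text \<open>
  Every finite GEC is isomorphic to one whose carrier is a set of natural numbers. A class of
  finite GECs that is closed under isomorphic copies is therefore represented by the set of its
  members carried by subsets of \<^typ>\<open>nat\<close>.
\<close>

type_synonym 'c gec_class = "(nat, 'c) gec set"

definition finitary_structure :: "'c gec_class \<Rightarrow> bool" where
  "finitary_structure F \<longleftrightarrow>
     (\<forall>(V, k)\<in>F. is_gec V k \<and> finite V \<and> V \<noteq> {}) \<and>
     (\<forall>(V, k)\<in>F. \<forall>A. A \<subseteq> V \<and> A \<noteq> {} \<longrightarrow> (A, k) \<in> F) \<and>
     (\<forall>(V, k)\<in>F. \<forall>W l. is_gec W l \<and> (\<exists>f. gec_iso V k W l f) \<longrightarrow> (W, l) \<in> F)"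

text \<open>
  The requirement that the colours form a set holds automatically, since colours are drawn from a type.
\<close>

definition proper_structure :: "'c gec_class \<Rightarrow> bool" where
  "proper_structure F \<longleftrightarrow> finitary_structure F \<and> (\<exists>p. \<forall>(V, k)\<in>F. \<forall>z\<in>V. k z z = p)"

definition mbp :: "'c gec_class \<Rightarrow> bool" where
  "mbp F \<longleftrightarrow> (\<forall>c. \<exists>N. \<forall>(V, k)\<in>F. (\<forall>x\<in>V. \<forall>y\<in>V. x \<noteq> y \<longrightarrow> k x y = c) \<longrightarrow> card V \<le> N)"

text \<open>
  In an incomplete GEC \<open>(V, a, b, k)\<close> the values \<open>k a b\<close> and \<open>k b a\<close> are meaningless, and none of the
  notions below depends on them. Those affiliated with a class of finite GECs are finite, so that
  carriers in \<^typ>\<open>nat\<close> suffice in the notions relative to such a class.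
\<close>

definition incomplete_gec :: "'v set \<Rightarrow> 'v \<Rightarrow> 'v \<Rightarrow> ('v \<Rightarrow> 'v \<Rightarrow> 'c) \<Rightarrow> bool" where
  "incomplete_gec V a b k \<longleftrightarrow> a \<in> V \<and> b \<in> V \<and> a \<noteq> b \<and>
     (\<forall>x\<in>V. \<forall>y\<in>V. \<forall>z\<in>V. (x, y) \<notin> {(a, b), (b, a)} \<longrightarrow> (k x y = k z z \<longleftrightarrow> x = y)) \<and>
     (\<forall>x\<in>V. \<forall>y\<in>V. (x, y) \<notin> {(a, b), (b, a)} \<longrightarrow> k y x = k x y)"

definition non_symmetric :: "'v set \<Rightarrow> 'v \<Rightarrow> 'v \<Rightarrow> ('v \<Rightarrow> 'v \<Rightarrow> 'c) \<Rightarrow> bool" where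
  "non_symmetric V a b k \<longleftrightarrow> (\<exists>c\<in>V - {a, b}. k a c \<noteq> k b c)"

definition affiliated ::
  "'c gec_class \<Rightarrow> nat set \<Rightarrow> nat \<Rightarrow> nat \<Rightarrow> (nat \<Rightarrow> nat \<Rightarrow> 'c) \<Rightarrow> bool" where
  "affiliated F V a b k \<longleftrightarrow> (V - {a}, k) \<in> F \<and> (V - {b}, k) \<in> F"

definition fill_in :: "'v \<Rightarrow> 'v \<Rightarrow> ('v \<Rightarrow> 'v \<Rightarrow> 'c) \<Rightarrow> 'c \<Rightarrow> 'v \<Rightarrow> 'v \<Rightarrow> 'c" where
  "fill_in a b k c x y = (if (x, y) \<in> {(a, b), (b, a)} then c else k x y)"

definition Delta ::
  "'c gec_class \<Rightarrow> nat set \<Rightarrow> nat \<Rightarrow> nat \<Rightarrow> (nat \<Rightarrow> nat \<Rightarrow> 'c) \<Rightarrow> 'c set" where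
  "Delta F V a b k = {c. (V, fill_in a b k c) \<in> F}"

definition has_AP :: "'c gec_class \<Rightarrow> bool" where
  "has_AP F \<longleftrightarrow>
     (\<forall>V a b k. incomplete_gec V a b k \<and> non_symmetric V a b k \<and> affiliated F V a b k
        \<longrightarrow> Delta F V a b k \<noteq> {})"

definition skeletoid :: "'c gec_class \<Rightarrow> bool" where
  "skeletoid F \<longleftrightarrow> proper_structure F \<and> mbp F \<and> has_AP F"

definition skeleton :: "'v set \<Rightarrow> ('v \<Rightarrow> 'v \<Rightarrow> 'c) \<Rightarrow> 'c gec_class" where
  "skeleton V k = {(W, l). \<exists>A f. A \<subseteq> V \<and> finite A \<and> A \<noteq> {} \<and> gec_iso A k W l f}"

text \<open>
  The carrier of the generating GEC has to be taken from a fixed type. An AB-HO GEC has no infinite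
  set all of whose edges have one colour (a non-surjective injection of a maximal such set into
  itself would not extend to an automorphism), so by the theorem of Erdos and Rado its size is at
  most the cardinality of the power set of \<open>'c + nat\<close>. The type chosen here hence contains a copy
  of every AB-HO GEC with colours in \<open>'c\<close>.
\<close>

definition is_skeleton :: "'c gec_class \<Rightarrow> bool" where
  "is_skeleton F \<longleftrightarrow>
     (\<exists>(V :: ('c + nat) set set) k. ab_ho V k \<and> F = skeleton V k)"

text \<open>
  The locale \<^locale>\<open>Metric_space\<close> requires non-negativity and symmetry on the whole type, whence the
  extension by zero outside the carrier.
\<close>

definition metric_gec :: "'v set \<Rightarrow> ('v \<Rightarrow> 'v \<Rightarrow> real) \<Rightarrow> bool" where
  "metric_gec V d \<longleftrightarrow> Metric_space V (\<lambda>x y. if x \<in> V \<and> y \<in> V then d x y else 0)"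

definition metric_skeletoid :: "real gec_class \<Rightarrow> bool" where
  "metric_skeletoid F \<longleftrightarrow> skeletoid F \<and> (\<forall>(V, d)\<in>F. metric_gec V d)"

definition edge_closed :: "real gec_class \<Rightarrow> bool" where
  "edge_closed F \<longleftrightarrow>
     (\<forall>V a b k. incomplete_gec V a b k \<and> non_symmetric V a b k \<and> affiliated F V a b k
        \<longrightarrow> closed (Delta F V a b k))"

text \<open>
  The metrics on \<open>{1..n}\<close>, normalised to be zero off \<open>{1..n}\<close> so that each of them is represented
  exactly once. The topology of \<^typ>\<open>nat \<Rightarrow> nat \<Rightarrow> real\<close> is that of pointwise convergence.
\<close>

definition metrics_on :: "nat \<Rightarrow> (nat \<Rightarrow> nat \<Rightarrow> real) set" where
  "metrics_on n =
     {d. Metric_space {1..n} d \<and> (\<forall>x y. x \<notin> {1..n} \<or> y \<notin> {1..n} \<longrightarrow> d x y = 0)}"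

definition metrics_in :: "real gec_class \<Rightarrow> nat \<Rightarrow> (nat \<Rightarrow> nat \<Rightarrow> real) set" where
  "metrics_in F n = {d \<in> metrics_on n. ({1..n}, d) \<in> F}"

definition bounded_metrics_in :: "real gec_class \<Rightarrow> real \<Rightarrow> nat \<Rightarrow> (nat \<Rightarrow> nat \<Rightarrow> real) set" where
  "bounded_metrics_in F r n = {d \<in> metrics_in F n. \<forall>i\<in>{1..n}. \<forall>j\<in>{1..n}. d i j \<le> r}"

definition layer_closed :: "real gec_class \<Rightarrow> bool" where
  "layer_closed F \<longleftrightarrow> (\<forall>n>1. closedin (top_of_set (metrics_on n)) (metrics_in F n))"

definition heine_borel :: "'a set \<Rightarrow> ('a \<Rightarrow> 'a \<Rightarrow> real) \<Rightarrow> bool" where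
  "heine_borel X d \<longleftrightarrow>
     (\<forall>x\<in>X. \<forall>r. compactin (Metric_space.mtopology X d) (Metric_space.mcball X d x r))"

definition hereditary_disconnected :: "'a topology \<Rightarrow> bool" where
  "hereditary_disconnected T \<longleftrightarrow> (\<forall>C\<in>connected_components_of T. \<exists>x. C = {x})"

definition locally_hereditary_disconnected :: "'a topology \<Rightarrow> bool" where
  "locally_hereditary_disconnected T \<longleftrightarrow>
     (\<exists>\<U>. (\<forall>U\<in>\<U>. openin T U \<and> hereditary_disconnected (subtopology T U)) \<and> \<Union>\<U> = topspace T)"

text \<open>
  An arc is a homeomorphic copy of the unit interval. In Hausdorff spaces being equal or joined by
  an arc is an equivalence relation.
\<close>

definition arc_joined :: "'a topology \<Rightarrow> 'a \<Rightarrow> 'a \<Rightarrow> bool" where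
  "arc_joined T x y \<longleftrightarrow>
     (\<exists>g. embedding_map (top_of_set {0..1::real}) T g \<and> g 0 = x \<and> g 1 = y)"

definition arc_components_of :: "'a topology \<Rightarrow> 'a set set" where
  "arc_components_of T = (\<lambda>x. {y \<in> topspace T. y = x \<or> arc_joined T x y}) ` topspace T"

end

theory Submission
  imports Defs "HOL-Library.Ramsey"
begin

text \<open>
  Call \<open>(V, k)\<close> an \<open>F\<close>-space if all its finite subspaces are copies of members of the class \<open>F\<close>; the set
  \<open>V\<close> may be infinite and of any type (\<open>age_in\<close>).

  A layer-closed metric skeletoid \<open>F\<close> is a skeleton because a maximal \<open>F\<close>-space generates it. The
  colours that complete a finite non-symmetric incomplete space form a set that is non-empty by AP,
  bounded by the triangle inequality, and closed because limits of members are members (this is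
  edge-closedness). By compactness, one-point amalgamation therefore extends from finite \<open>F\<close>-spaces to
  all \<open>F\<close>-spaces (\<open>amalgamation\<close>), so a maximal \<open>F\<close>-space realises every one-point extension of every
  one of its subsets (\<open>maximal_saturated\<close>). Such a saturated space contains a copy of each member of
  \<open>F\<close>, and a maximal partial isometry of it into itself is both total and surjective
  (\<open>saturated_ab_ho\<close>). Maximality has to be understood inside a fixed type, and this makes sense only
  if \<open>F\<close>-spaces cannot fill that type. They cannot: an infinite bounded set of points with mutual
  distances at least \<open>\<epsilon>\<close> would contain, by Ramsey's theorem, almost equilateral subspaces of every
  finite size, and in the limit \<open>F\<close> would contain equilateral spaces of one edge length and every
  finite size, against MBP (\<open>no_infinite_separated_subset\<close>). Thus \<open>F\<close>-spaces are separable and have at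
  most continuum many points.

  For an AB-HO space \<open>X\<close> the other parts use that finite or infinite configurations can be moved. If
  balls are compact, copies in \<open>X\<close> of a convergent sequence of finite spaces can be moved so that they
  share a point; a subsequence of them then converges in \<open>X\<close>. Conversely, if the layers
  are closed, the space formed by a Cauchy sequence and its ideal limit has all its finite
  subspaces in the skeleton. Being countable it embeds into \<open>X\<close>, and an automorphism that takes the
  given sequence to its copy takes some point of \<open>X\<close> to the copy of the limit.

  For connectedness, two-point homogeneity is decisive: a connected set containing \<open>x\<close> and a point at
  distance \<open>s\<close> from \<open>x\<close> contains points at all distances up to \<open>s\<close>, so that a copy of it fixing \<open>x\<close>
  reaches any prescribed point within distance \<open>s\<close>. Applied to small connected sets this gives local
  connectedness, and applied to an unbounded component it gives connectedness. Finally, an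
  automorphism permutes the components as well as the arc components, hence preserves each of these
  sets that contains some point together with its image.
\<close>

section \<open>Spaces whose finite subspaces lie in a class\<close>

definition age_in :: "'c gec_class \<Rightarrow> 'v set \<Rightarrow> ('v \<Rightarrow> 'v \<Rightarrow> 'c) \<Rightarrow> bool" where
  "age_in F V k \<longleftrightarrow> is_gec V k \<and> skeleton V k \<subseteq> F"

lemma partial_morphismD:
  assumes "partial_morphism V k W l A f"
  shows "a \<in> A \<Longrightarrow> a \<in> V" "a \<in> A \<Longrightarrow> f a \<in> W" "a \<in> A \<Longrightarrow> b \<in> A \<Longrightarrow> k a b = l (f a) (f b)"
  using assms unfolding partial_morphism_def by blast+

lemma partial_morphismI:
  assumes "A \<subseteq> V" "\<And>a. a \<in> A \<Longrightarrow> f a \<in> W"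
    "\<And>a b. a \<in> A \<Longrightarrow> b \<in> A \<Longrightarrow> k a b = l (f a) (f b)"
  shows "partial_morphism V k W l A f"
  using assms unfolding partial_morphism_def by blast

lemma is_gec_pullback:
  assumes "is_gec W l" "partial_morphism V k W l V f" "inj_on f V"
  shows "is_gec V k"
proof -
  note f = partial_morphismD(2)[OF assms(2)] and k = partial_morphismD(3)[OF assms(2)]
  have 1: "k x y = k z z \<longleftrightarrow> x = y" if "x \<in> V" "y \<in> V" "z \<in> V" for x y z
  proof -
    have "l (f x) (f y) = l (f z) (f z) \<longleftrightarrow> f x = f y"
      using assms(1) f that unfolding is_gec_def by blast
    then show ?thesis using inj_onD[OF assms(3)] k that by metis
  qed
  have 2: "k y x = k x y" if "x \<in> V" "y \<in> V" for x y
  proof -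
    have "l (f y) (f x) = l (f x) (f y)" using assms(1) f that unfolding is_gec_def by blast
    then show ?thesis using k that by metis
  qed
  show ?thesis unfolding is_gec_def using 1 2 by blast
qed

lemma is_gec_subset:
  assumes "is_gec V k" "A \<subseteq> V" shows "is_gec A k"
proof (rule is_gec_pullback[OF assms(1)])
  show "partial_morphism A k V k A (\<lambda>x. x)" by (rule partial_morphismI) (use assms(2) in auto)
qed simp

lemma is_gec_cong:
  assumes "is_gec V k" "\<And>x y. x \<in> V \<Longrightarrow> y \<in> V \<Longrightarrow> l x y = k x y"
  shows "is_gec V l"
proof (rule is_gec_pullback[OF assms(1)])
  show "partial_morphism V l V k V (\<lambda>x. x)" by (rule partial_morphismI) (use assms(2) in auto)
qed simp

lemma partial_morphism_inj_on:
  assumes "is_gec V k" "is_gec W l" "partial_morphism V k W l A f"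
  shows "inj_on f A"
proof (rule inj_onI)
  fix x y assume xy: "x \<in> A" "y \<in> A" "f x = f y"
  then have "k x y = k y y" and A: "x \<in> V" "y \<in> V"
    using partial_morphismD[OF assms(3)] by metis+
  then show "x = y" using assms(1) A unfolding is_gec_def by blast
qed

lemma partial_morphism_comp:
  assumes "partial_morphism V k W l A f" "partial_morphism W l U m (f ` A) g"
  shows "partial_morphism V k U m A (\<lambda>x. g (f x))"
  by (rule partial_morphismI)
    (use partial_morphismD(1)[OF assms(1)] in
      \<open>simp_all add: subset_iff partial_morphismD(2,3)[OF assms(1)] partial_morphismD(2,3)[OF assms(2)]\<close>)

lemma partial_morphism_subset:
  assumes "partial_morphism V k W l A f" "B \<subseteq> A"
  shows "partial_morphism V k W l B f"
  by (rule partial_morphismI) (use partial_morphismD[OF assms(1)] assms(2) in blast)+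

lemma partial_morphism_inv:
  assumes "partial_morphism V k W l A f" "inj_on f A"
  shows "partial_morphism W l V k (f ` A) (inv_into A f)"
  by (rule partial_morphismI) (use partial_morphismD[OF assms(1)] assms(2) in auto)

lemma gec_iso_onto_image:
  assumes "partial_morphism V k W l V f" "inj_on f V"
  shows "gec_iso V k (f ` V) l f"
  unfolding gec_iso_def
proof
  show "partial_morphism V k (f ` V) l V f"
    by (rule partial_morphismI) (use partial_morphismD(3)[OF assms(1)] in auto)
  show "bij_betw f V (f ` V)" by (rule inj_on_imp_bij_betw[OF assms(2)])
qed

lemma gec_iso_inv:
  assumes "gec_iso V k W l f"
  shows "gec_iso W l V k (inv_into V f)"
proof -
  from assms have "partial_morphism V k W l V f" "inj_on f V" "f ` V = W"
    unfolding gec_iso_def bij_betw_def by auto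
  with partial_morphism_inv[of V k W l V f] bij_betw_inv_into[of f V W] show ?thesis
    unfolding gec_iso_def bij_betw_def by simp
qed

text \<open>The definition takes a subset of \<open>V\<close> and a copy of it; reading the copying map backwards, membership
  is embeddability into \<open>V\<close>, which composes and restricts without any bookkeeping of subsets.\<close>

lemma skeleton_iff:
  assumes V: "is_gec V k"
  shows "(W, l) \<in> skeleton V k \<longleftrightarrow>
    finite W \<and> W \<noteq> {} \<and> is_gec W l \<and> (\<exists>f. partial_morphism W l V k W f)"
proof
  assume "(W, l) \<in> skeleton V k"
  then obtain A f where A: "A \<subseteq> V" "finite A" "A \<noteq> {}" and f: "gec_iso A k W l f"
    unfolding skeleton_def by auto
  let ?g = "inv_into A f"
  have g: "gec_iso W l A k ?g" using gec_iso_inv[OF f] .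
  then have pm: "partial_morphism W l V k W ?g" and inj: "inj_on ?g W"
    using A unfolding gec_iso_def partial_morphism_def bij_betw_def by auto
  have "W = f ` A" using f unfolding gec_iso_def bij_betw_def by auto
  then show "finite W \<and> W \<noteq> {} \<and> is_gec W l \<and> (\<exists>f. partial_morphism W l V k W f)"
    using A pm is_gec_pullback[OF V pm inj] by auto
next
  assume *: "finite W \<and> W \<noteq> {} \<and> is_gec W l \<and> (\<exists>f. partial_morphism W l V k W f)"
  then obtain f where f: "partial_morphism W l V k W f" by blast
  have "inj_on f W" using partial_morphism_inj_on[OF _ V f] * by blast
  from gec_iso_inv[OF gec_iso_onto_image[OF f this]]
  have "gec_iso (f ` W) k W l (inv_into W f)" .
  moreover have "f ` W \<subseteq> V" using f unfolding partial_morphism_def by blast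
  ultimately show "(W, l) \<in> skeleton V k" using * unfolding skeleton_def by blast
qed

lemma age_in_is_gec: "age_in F V k \<Longrightarrow> is_gec V k"
  unfolding age_in_def by blast

lemma age_in_pullback:
  assumes W: "age_in F W l" and V: "is_gec V k" and f: "partial_morphism V k W l V f"
  shows "age_in F V k"
proof -
  have gW: "is_gec W l" using W by (rule age_in_is_gec)
  have "(U, m) \<in> skeleton W l" if "(U, m) \<in> skeleton V k" for U m
  proof -
    from that obtain g where U: "finite U" "U \<noteq> {}" "is_gec U m"
      and g: "partial_morphism U m V k U g"
      using skeleton_iff[OF V] by blast
    have "g ` U \<subseteq> V" using g unfolding partial_morphism_def by blast
    have "partial_morphism U m W l U (\<lambda>x. f (g x))"
      by (rule partial_morphism_comp[OF g partial_morphism_subset[OF f \<open>g ` U \<subseteq> V\<close>]])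
    then have "\<exists>h. partial_morphism U m W l U h" by (intro exI)
    then show ?thesis unfolding skeleton_iff[OF gW] using U by blast
  qed
  then have "skeleton V k \<subseteq> skeleton W l" by (rule subrelI)
  then show ?thesis using W V unfolding age_in_def by blast
qed

lemma age_in_subset:
  assumes "age_in F V k" "A \<subseteq> V"
  shows "age_in F A k"
proof (rule age_in_pullback[OF assms(1)])
  show "is_gec A k" by (rule is_gec_subset[OF age_in_is_gec[OF assms(1)] assms(2)])
  show "partial_morphism A k V k A (\<lambda>x. x)" by (rule partial_morphismI) (use assms(2) in auto)
qed

lemma age_in_cong:
  assumes "age_in F V k" "\<And>x y. x \<in> V \<Longrightarrow> y \<in> V \<Longrightarrow> l x y = k x y"
  shows "age_in F V l"
proof (rule age_in_pullback[OF assms(1)])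
  show "is_gec V l" by (rule is_gec_cong[OF age_in_is_gec[OF assms(1)]]) (rule assms(2))
  show "partial_morphism V l V k V (\<lambda>x. x)" by (rule partial_morphismI) (use assms(2) in auto)
qed

text \<open>The defining conditions of a GEC involve three points and those of the skeleton finitely
  many; this finite character is what makes Zorn's lemma applicable.\<close>

lemma age_in_finite_character:
  assumes fin: "\<And>S. S \<subseteq> V \<Longrightarrow> finite S \<Longrightarrow> age_in F S k"
  shows "age_in F V k"
proof -
  have gec: "is_gec V k"
  proof -
    have "is_gec {x, y, z} k" if "x \<in> V" "y \<in> V" "z \<in> V" for x y z
      using fin[of "{x, y, z}"] that age_in_is_gec by blast
    then show ?thesis unfolding is_gec_def by (metis insertCI)
  qed
  have "(U, m) \<in> F" if "(U, m) \<in> skeleton V k" for U m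
  proof -
    from that obtain g where U: "finite U" "U \<noteq> {}" "is_gec U m"
      and g: "partial_morphism U m V k U g"
      using skeleton_iff[OF gec] by blast
    have "g ` U \<subseteq> V" using g unfolding partial_morphism_def by blast
    then have age: "age_in F (g ` U) k" using fin U(1) by blast
    have "partial_morphism U m (g ` U) k U g" using g unfolding partial_morphism_def by blast
    then have "(U, m) \<in> skeleton (g ` U) k"
      unfolding skeleton_iff[OF age_in_is_gec[OF age]] using U by blast
    then show ?thesis using age unfolding age_in_def by blast
  qed
  then have "skeleton V k \<subseteq> F" by (rule subrelI)
  with gec show ?thesis unfolding age_in_def by blast
qed

lemma finitary_structureD:
  assumes "finitary_structure F" "(V, k) \<in> F"
  shows "is_gec V k" "A \<subseteq> V \<Longrightarrow> A \<noteq> {} \<Longrightarrow> (A, k) \<in> F"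
    "is_gec W l \<Longrightarrow> gec_iso V k W l f \<Longrightarrow> (W, l) \<in> F" "finite V" "V \<noteq> {}"
proof -
  have 1: "\<forall>(V, k)\<in>F. is_gec V k \<and> finite V \<and> V \<noteq> {}"
    and 2: "\<forall>(V, k)\<in>F. \<forall>A. A \<subseteq> V \<and> A \<noteq> {} \<longrightarrow> (A, k) \<in> F"
    and 3: "\<forall>(V, k)\<in>F. \<forall>W l. is_gec W l \<and> (\<exists>f. gec_iso V k W l f) \<longrightarrow> (W, l) \<in> F"
    using assms(1) unfolding finitary_structure_def by - (elim conjE, assumption)+
  show "is_gec V k" "finite V" "V \<noteq> {}" using bspec[OF 1 assms(2)] by simp_all
  show "A \<subseteq> V \<Longrightarrow> A \<noteq> {} \<Longrightarrow> (A, k) \<in> F" using bspec[OF 2 assms(2)] by simp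
  show "is_gec W l \<Longrightarrow> gec_iso V k W l f \<Longrightarrow> (W, l) \<in> F" using bspec[OF 3 assms(2)] by auto
qed

text \<open>Closure under subspaces and copies makes membership in \<open>F\<close> a property that no longer mentions the
  carrier type \<^typ>\<open>nat\<close>, so that \<^const>\<open>age_in\<close> extends \<open>F\<close> to arbitrary types.\<close>

lemma finitary_mem_iff_age_in:
  assumes F: "finitary_structure F" and V: "finite V" "V \<noteq> {}"
  shows "(V, k) \<in> F \<longleftrightarrow> age_in F V k"
proof
  assume VF: "(V, k) \<in> F"
  then have gec: "is_gec V k" by (rule finitary_structureD(1)[OF F])
  have "(U, m) \<in> F" if UV: "(U, m) \<in> skeleton V k" for U m
  proof -
    from UV obtain A f where A: "A \<subseteq> V" "finite A" "A \<noteq> {}" "gec_iso A k U m f"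
      unfolding skeleton_def by auto
    have AF: "(A, k) \<in> F" by (rule finitary_structureD(2)[OF F VF A(1,3)])
    have "is_gec U m" using UV unfolding skeleton_iff[OF gec] by blast
    then show ?thesis using finitary_structureD(3)[OF F AF _ A(4)] by blast
  qed
  then have "skeleton V k \<subseteq> F" by (rule subrelI)
  with gec show "age_in F V k" unfolding age_in_def by blast
next
  assume age: "age_in F V k"
  have "partial_morphism V k V k V (\<lambda>x. x)" by (simp add: partial_morphism_def)
  then have "(V, k) \<in> skeleton V k"
    unfolding skeleton_iff[OF age_in_is_gec[OF age]] using age_in_is_gec[OF age] V by blast
  then show "(V, k) \<in> F" using age unfolding age_in_def by blast
qed

lemma finitary_structure_skeleton:
  assumes X: "is_gec X d"
  shows "finitary_structure (skeleton X d)"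
proof -
  have "(A, k) \<in> skeleton X d" if "(V, k) \<in> skeleton X d" "A \<subseteq> V" "A \<noteq> {}" for V k A
  proof -
    from that obtain f where V: "finite V" "is_gec V k" and f: "partial_morphism V k X d V f"
      using skeleton_iff[OF X] by blast
    have "partial_morphism A k X d A f" using f that(2) unfolding partial_morphism_def by blast
    moreover have "finite A" "is_gec A k" using that V by (auto intro: finite_subset is_gec_subset)
    ultimately show ?thesis using skeleton_iff[OF X] that(3) by blast
  qed
  moreover have "(W, l) \<in> skeleton X d"
    if "(V, k) \<in> skeleton X d" "is_gec W l" "gec_iso V k W l f" for V k W l f
  proof -
    from that obtain h where V: "finite V" "V \<noteq> {}" and h: "partial_morphism V k X d V h"
      using skeleton_iff[OF X] by blast
    have W: "W = f ` V" using that(3) unfolding gec_iso_def bij_betw_def by blast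
    have g: "gec_iso W l V k (inv_into V f)" by (rule gec_iso_inv[OF that(3)])
    then have "inv_into V f ` W = V" "partial_morphism W l V k W (inv_into V f)"
      unfolding gec_iso_def bij_betw_def by auto
    with partial_morphism_comp[of W l V k W "inv_into V f" X d h] h
    have "partial_morphism W l X d W (\<lambda>x. h (inv_into V f x))" by simp
    then show ?thesis using skeleton_iff[OF X] that(2) V W by blast
  qed
  moreover have "is_gec V k \<and> finite V \<and> V \<noteq> {}" if "(V, k) \<in> skeleton X d" for V k
    using that unfolding skeleton_iff[OF X] by blast
  ultimately show ?thesis
    unfolding finitary_structure_def case_prod_unfold
    by (intro conjI ballI allI impI) (metis prod.collapse)+
qed

text \<open>Finite GECs over an arbitrary type are compared with a class through a copy carried by natural
  numbers.\<close>

lemma finite_nat_copy: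
  assumes age: "age_in F V k" and V: "finite V" "V \<noteq> {}"
  obtains W l e where "(W, l) \<in> F" "partial_morphism V k W l V e" "inj_on e V"
proof -
  obtain e :: "_ \<Rightarrow> nat" where e: "inj_on e V"
    using finite_imp_inj_to_nat_seg[OF V(1)] by blast
  let ?k = "\<lambda>i j. k (inv_into V e i) (inv_into V e j)"
  have pm: "partial_morphism V k (e ` V) ?k V e"
    by (rule partial_morphismI) (use e in auto)
  have pm': "partial_morphism (e ` V) ?k V k (e ` V) (inv_into V e)"
    by (rule partial_morphism_inv[OF pm e])
  have "is_gec (e ` V) ?k"
    by (rule is_gec_pullback[OF age_in_is_gec[OF age] pm' inj_on_inv_into]) simp
  then have "(e ` V, ?k) \<in> skeleton V k"
    unfolding skeleton_iff[OF age_in_is_gec[OF age]] using pm' V by blast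
  then have "(e ` V, ?k) \<in> F" using age unfolding age_in_def by blast
  from that[OF this pm e] show thesis .
qed

lemma finite_age_in_skeleton_embeds:
  assumes X: "is_gec X d" and V: "finite V" and age: "age_in (skeleton X d) V k"
  shows "\<exists>f. partial_morphism V k X d V f"
proof (cases "V = {}")
  case True
  then show ?thesis by (auto simp: partial_morphism_def)
next
  case False
  from finite_nat_copy[OF age V False] obtain W l e
    where W: "(W, l) \<in> skeleton X d" and pm: "partial_morphism V k W l V e" by blast
  from W obtain h where h: "partial_morphism W l X d W h"
    unfolding skeleton_iff[OF X] by blast
  have "e ` V \<subseteq> W" using partial_morphismD(2)[OF pm] by blast
  from partial_morphism_comp[OF pm partial_morphism_subset[OF h this]]
  show ?thesis by (intro exI)
qed

lemma metric_gec_iff: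
  "metric_gec V d \<longleftrightarrow>
     (\<forall>x\<in>V. \<forall>y\<in>V. 0 \<le> d x y \<and> d y x = d x y \<and> (d x y = 0 \<longleftrightarrow> x = y)) \<and>
     (\<forall>x\<in>V. \<forall>y\<in>V. \<forall>z\<in>V. d x z \<le> d x y + d y z)"
  unfolding metric_gec_def Metric_space_def by auto

lemma metric_gecD:
  assumes "metric_gec V d"
  shows "x \<in> V \<Longrightarrow> y \<in> V \<Longrightarrow> 0 \<le> d x y" "x \<in> V \<Longrightarrow> y \<in> V \<Longrightarrow> d y x = d x y"
    "x \<in> V \<Longrightarrow> y \<in> V \<Longrightarrow> d x y = 0 \<longleftrightarrow> x = y"
    "x \<in> V \<Longrightarrow> y \<in> V \<Longrightarrow> z \<in> V \<Longrightarrow> d x z \<le> d x y + d y z"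
proof -
  have 1: "\<forall>x\<in>V. \<forall>y\<in>V. 0 \<le> d x y \<and> d y x = d x y \<and> (d x y = 0 \<longleftrightarrow> x = y)"
    and 2: "\<forall>x\<in>V. \<forall>y\<in>V. \<forall>z\<in>V. d x z \<le> d x y + d y z"
    using assms unfolding metric_gec_iff by - (elim conjE, assumption)+
  show "x \<in> V \<Longrightarrow> y \<in> V \<Longrightarrow> 0 \<le> d x y" "x \<in> V \<Longrightarrow> y \<in> V \<Longrightarrow> d y x = d x y"
    "x \<in> V \<Longrightarrow> y \<in> V \<Longrightarrow> d x y = 0 \<longleftrightarrow> x = y"
    using bspec[OF bspec[OF 1, of x], of y] by simp_all
  show "x \<in> V \<Longrightarrow> y \<in> V \<Longrightarrow> z \<in> V \<Longrightarrow> d x z \<le> d x y + d y z"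
    using bspec[OF bspec[OF bspec[OF 2, of x], of y], of z] .
qed

lemma metric_gecI:
  assumes "\<And>x y. x \<in> V \<Longrightarrow> y \<in> V \<Longrightarrow> 0 \<le> d x y" "\<And>x y. x \<in> V \<Longrightarrow> y \<in> V \<Longrightarrow> d y x = d x y"
    "\<And>x y. x \<in> V \<Longrightarrow> y \<in> V \<Longrightarrow> d x y = 0 \<longleftrightarrow> x = y"
    "\<And>x y z. x \<in> V \<Longrightarrow> y \<in> V \<Longrightarrow> z \<in> V \<Longrightarrow> d x z \<le> d x y + d y z"
  shows "metric_gec V d"
  unfolding metric_gec_iff by (intro conjI ballI assms)

lemma metric_gec_is_gec:
  assumes "metric_gec V d" shows "is_gec V d"
  unfolding is_gec_def
proof (intro conjI ballI)
  fix x y z assume "x \<in> V" "y \<in> V" "z \<in> V"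
  then show "d x y = d z z \<longleftrightarrow> x = y" using metric_gecD(3)[OF assms] by metis
qed (rule metric_gecD(2)[OF assms])

lemma metric_gec_pullback:
  assumes "metric_gec W l" "partial_morphism V k W l V f" "inj_on f V"
  shows "metric_gec V k"
proof -
  note f = partial_morphismD(2)[OF assms(2)] and k = partial_morphismD(3)[OF assms(2)]
  note l = metric_gecD[OF assms(1)]
  show ?thesis
  proof (rule metric_gecI)
    fix x y assume xy: "x \<in> V" "y \<in> V"
    show "0 \<le> k x y" unfolding k[OF xy] by (rule l(1)[OF f[OF xy(1)] f[OF xy(2)]])
    show "k y x = k x y" unfolding k[OF xy] k[OF xy(2,1)] by (rule l(2)[OF f[OF xy(1)] f[OF xy(2)]])
    show "k x y = 0 \<longleftrightarrow> x = y"
      unfolding k[OF xy] l(3)[OF f[OF xy(1)] f[OF xy(2)]] by (rule inj_on_eq_iff[OF assms(3) xy])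
    fix z assume z: "z \<in> V"
    show "k x z \<le> k x y + k y z"
      unfolding k[OF xy] k[OF xy(1) z] k[OF xy(2) z]
      by (rule l(4)[OF f[OF xy(1)] f[OF xy(2)] f[OF z]])
  qed
qed

lemma Metric_space_metric_gec: "Metric_space X d \<Longrightarrow> metric_gec X d"
  unfolding metric_gec_iff Metric_space_def by auto

lemma metric_skeleton:
  assumes "metric_gec X d" shows "\<forall>(V, k)\<in>skeleton X d. metric_gec V k"
proof clarify
  fix V k assume "(V, k) \<in> skeleton X d"
  then obtain f where V: "is_gec V k" "partial_morphism V k X d V f"
    using skeleton_iff[OF metric_gec_is_gec[OF assms]] by blast
  then show "metric_gec V k"
    using metric_gec_pullback[OF assms V(2)] partial_morphism_inj_on metric_gec_is_gec[OF assms]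
    by blast
qed

lemma age_in_metric_class:
  assumes F: "\<forall>(V, d)\<in>F. metric_gec V d" and age: "age_in F V k"
  shows "metric_gec V k"
proof -
  have "metric_gec {x, y, z} k" if xyz: "x \<in> V" "y \<in> V" "z \<in> V" for x y z
  proof -
    let ?S = "{x, y, z}"
    have S: "age_in F ?S k" by (rule age_in_subset[OF age]) (use xyz in auto)
    from finite_nat_copy[OF S] obtain W l e
      where W: "(W, l) \<in> F" and pm: "partial_morphism ?S k W l ?S e" and e: "inj_on e ?S" by auto
    have "metric_gec W l" using bspec[OF F W] by simp
    from metric_gec_pullback[OF this pm e] show ?thesis .
  qed
  note three = this
  show ?thesis
  proof (rule metric_gecI)
    fix x y assume xy: "x \<in> V" "y \<in> V"
    note m = metric_gecD[OF three[OF xy(1) xy(2) xy(2)], of x y]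
    show "0 \<le> k x y" "k y x = k x y" "k x y = 0 \<longleftrightarrow> x = y" using m(1-3) by simp_all
    fix z assume z: "z \<in> V"
    show "k x z \<le> k x y + k y z"
      by (rule metric_gecD(4)[OF three[OF xy z]]) simp_all
  qed
qed

section \<open>Maximal extensions for properties of finite character\<close>

text \<open>Zorn's lemma for pairs of a set \<open>A\<close> and a function on \<open>A \<times> A\<close>, ordered by extension. Pairs are
  encoded by the graphs of the functions, which turns the order into inclusion. By finite character
  the union of a chain inherits the property: each finite part of the union lies in one member.\<close>

lemma maximal_extension:
  fixes P :: "'a set \<Rightarrow> ('a \<Rightarrow> 'a \<Rightarrow> 'b) \<Rightarrow> bool"
  assumes sub: "\<And>A B k. P A k \<Longrightarrow> B \<subseteq> A \<Longrightarrow> P B k"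
    and fin: "\<And>A k. (\<And>S. S \<subseteq> A \<Longrightarrow> finite S \<Longrightarrow> P S k) \<Longrightarrow> P A k"
    and cong: "\<And>A k l. P A k \<Longrightarrow> (\<And>x y. x \<in> A \<Longrightarrow> y \<in> A \<Longrightarrow> l x y = k x y) \<Longrightarrow> P A l"
    and start: "P A k"
  obtains B l where "A \<subseteq> B" "P B l" "\<And>x y. x \<in> A \<Longrightarrow> y \<in> A \<Longrightarrow> l x y = k x y"
    "\<And>C m. B \<subseteq> C \<Longrightarrow> P C m \<Longrightarrow> (\<And>x y. x \<in> B \<Longrightarrow> y \<in> B \<Longrightarrow> m x y = l x y) \<Longrightarrow> C = B"
proof -
  define G where "G B l = {(x, y, l x y) |x y. x \<in> B \<and> y \<in> B}" for B and l :: "'a \<Rightarrow> 'a \<Rightarrow> 'b"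
  have mem: "(x, y, r) \<in> G B l \<longleftrightarrow> x \<in> B \<and> y \<in> B \<and> r = l x y" for x y r B l
    unfolding G_def by blast
  have le: "G B l \<subseteq> G C m \<longleftrightarrow> B \<subseteq> C \<and> (\<forall>x\<in>B. \<forall>y\<in>B. m x y = l x y)" for B l C m
  proof
    assume L: "G B l \<subseteq> G C m"
    have "x \<in> C \<and> y \<in> C \<and> m x y = l x y" if "x \<in> B" "y \<in> B" for x y
      using subsetD[OF L, of "(x, y, l x y)"] that unfolding mem by metis
    then show "B \<subseteq> C \<and> (\<forall>x\<in>B. \<forall>y\<in>B. m x y = l x y)" by blast
  next
    assume R: "B \<subseteq> C \<and> (\<forall>x\<in>B. \<forall>y\<in>B. m x y = l x y)"
    show "G B l \<subseteq> G C m"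
    proof clarify
      fix x y r assume "(x, y, r) \<in> G B l"
      then show "(x, y, r) \<in> G C m" using R unfolding mem by (metis subsetD)
    qed
  qed
  define \<A> where "\<A> = {G B l |B l. P B l \<and> G A k \<subseteq> G B l}"
  have "\<exists>M\<in>\<A>. \<forall>X\<in>\<A>. M \<subseteq> X \<longrightarrow> X = M"
  proof (rule subset_Zorn_nonempty)
    show "\<A> \<noteq> {}" using start unfolding \<A>_def by blast
  next
    fix \<C> assume ne: "\<C> \<noteq> {}" and ch: "subset.chain \<A> \<C>"
    define U where "U = {x. \<exists>r. (x, x, r) \<in> \<Union>\<C>}"
    define l where "l x y = (SOME r. (x, y, r) \<in> \<Union>\<C>)" for x y
    have ex: "\<exists>B m. M = G B m \<and> P B m \<and> G A k \<subseteq> M" if "M \<in> \<C>" for M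
      using ch that unfolding subset.chain_def \<A>_def by blast
    have big: "\<exists>B m. G B m \<in> \<C> \<and> P B m \<and> K \<subseteq> G B m" if "finite K" "K \<subseteq> \<Union>\<C>" for K
      using finite_subset_Union_chain[OF that ne ch] ex by metis
    have agree: "l x y = m x y" if M: "G B m \<in> \<C>" and xy: "x \<in> B" "y \<in> B" for B m x y
    proof -
      have 1: "(x, y, m x y) \<in> \<Union>\<C>" using M xy mem by blast
      then have 2: "(x, y, l x y) \<in> \<Union>\<C>" unfolding l_def by (rule someI)
      obtain C n where "{(x, y, m x y), (x, y, l x y)} \<subseteq> G C n"
        using big[of "{(x, y, m x y), (x, y, l x y)}"] 1 2 by auto
      then show ?thesis using mem by (metis insert_subset)
    qed
    have UU: "\<Union>\<C> = G U l"
    proof (intro equalityI subsetI)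
      fix p assume p: "p \<in> \<Union>\<C>"
      obtain x y r where pq: "p = (x, y, r)" by (cases p)
      from p obtain B m where M: "G B m \<in> \<C>" "(x, y, r) \<in> G B m" unfolding pq using ex by (metis UnionE)
      then have xy: "x \<in> B" "y \<in> B" "r = m x y" unfolding mem by blast+
      then have "(x, x, m x x) \<in> \<Union>\<C>" "(y, y, m y y) \<in> \<Union>\<C>" using M(1) mem by blast+
      then have "x \<in> U" "y \<in> U" unfolding U_def mem_Collect_eq by metis+
      then show "p \<in> G U l" unfolding pq mem using agree[OF M(1) xy(1,2)] xy(3) by metis
    next
      fix p assume p: "p \<in> G U l"
      obtain x y r where pq: "p = (x, y, r)" by (cases p)
      from p have r: "r = l x y" and "x \<in> U" "y \<in> U" unfolding pq mem by blast+
      then obtain s t where st: "(x, x, s) \<in> \<Union>\<C>" "(y, y, t) \<in> \<Union>\<C>" unfolding U_def by blast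
      then obtain B m where M: "G B m \<in> \<C>" "{(x, x, s), (y, y, t)} \<subseteq> G B m"
        using big[of "{(x, x, s), (y, y, t)}"] by auto
      then have xy: "x \<in> B" "y \<in> B" using mem by (metis insert_subset)+
      then have "(x, y, m x y) \<in> \<Union>\<C>" using M(1) mem by blast
      then show "p \<in> \<Union>\<C>" using agree[OF M(1) xy] r pq by simp
    qed
    have "P U l"
    proof (rule fin)
      fix S assume S: "S \<subseteq> U" "finite S"
      have "(\<lambda>x. (x, x, l x x)) ` S \<subseteq> \<Union>\<C>"
        unfolding UU by (rule image_subsetI) (use S(1) in \<open>auto simp: mem\<close>)
      then obtain B m where M: "G B m \<in> \<C>" "P B m" "(\<lambda>x. (x, x, l x x)) ` S \<subseteq> G B m"
        using big[of "(\<lambda>x. (x, x, l x x)) ` S"] S(2) by auto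
      have SB: "S \<subseteq> B"
      proof
        fix x assume "x \<in> S"
        then have "(x, x, l x x) \<in> G B m" using M(3) by blast
        then show "x \<in> B" unfolding mem by (rule conjunct1)
      qed
      show "P S l" by (rule cong[OF sub[OF M(2) SB]]) (rule agree[OF M(1) subsetD[OF SB] subsetD[OF SB]])
    qed
    moreover have "G A k \<subseteq> G U l" using ne ex unfolding UU[symmetric] by blast
    ultimately show "\<Union>\<C> \<in> \<A>" unfolding \<A>_def UU by blast
  qed
  then obtain M where M: "M \<in> \<A>" and max: "\<And>X. X \<in> \<A> \<Longrightarrow> M \<subseteq> X \<Longrightarrow> X = M" by metis
  from M obtain B l where MB: "M = G B l" and B: "P B l" "G A k \<subseteq> G B l"
    unfolding \<A>_def by auto
  show thesis
  proof (rule that[OF _ B(1)])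
    show "A \<subseteq> B" using B(2) unfolding le by (rule conjunct1)
    show "l x y = k x y" if "x \<in> A" "y \<in> A" for x y
      using conjunct2[OF B(2)[unfolded le]] that by simp
    fix C m assume C: "B \<subseteq> C" "P C m" "\<And>x y. x \<in> B \<Longrightarrow> y \<in> B \<Longrightarrow> m x y = l x y"
    then have BC: "G B l \<subseteq> G C m" unfolding le by simp
    then have "G A k \<subseteq> G C m" using B(2) by (rule order.trans[rotated])
    then have "G C m \<in> \<A>" using C(2) unfolding \<A>_def by auto
    from max[OF this] BC have "G C m \<subseteq> G B l" unfolding MB by simp
    then have "C \<subseteq> B" unfolding le by (rule conjunct1)
    then show "C = B" using C(1) by (rule equalityI)
  qed
qed

lemma maximal_extension_fun:
  fixes P :: "'a set \<Rightarrow> ('a \<Rightarrow> 'b) \<Rightarrow> bool"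
  assumes sub: "\<And>A B f. P A f \<Longrightarrow> B \<subseteq> A \<Longrightarrow> P B f"
    and fin: "\<And>A f. (\<And>S. S \<subseteq> A \<Longrightarrow> finite S \<Longrightarrow> P S f) \<Longrightarrow> P A f"
    and cong: "\<And>A f g. P A f \<Longrightarrow> (\<And>x. x \<in> A \<Longrightarrow> g x = f x) \<Longrightarrow> P A g"
    and start: "P A f"
  obtains B g where "A \<subseteq> B" "P B g" "\<And>x. x \<in> A \<Longrightarrow> g x = f x"
    "\<And>C h. B \<subseteq> C \<Longrightarrow> P C h \<Longrightarrow> (\<And>x. x \<in> B \<Longrightarrow> h x = g x) \<Longrightarrow> C = B"
proof -
  let ?P = "\<lambda>A k. P A (\<lambda>x. k x x)"
  obtain B l where B: "A \<subseteq> B" "?P B l" "\<And>x y. x \<in> A \<Longrightarrow> y \<in> A \<Longrightarrow> l x y = f x"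
    and max: "\<And>C m. B \<subseteq> C \<Longrightarrow> ?P C m \<Longrightarrow> (\<And>x y. x \<in> B \<Longrightarrow> y \<in> B \<Longrightarrow> m x y = l x y) \<Longrightarrow> C = B"
  proof (rule maximal_extension[of ?P A "\<lambda>x y. f x"])
    show "?P B k" if "?P A k" "B \<subseteq> A" for A B k using sub that by blast
    show "?P A k" if "\<And>S. S \<subseteq> A \<Longrightarrow> finite S \<Longrightarrow> ?P S k" for A k using fin that by blast
    show "?P A l" if "?P A k" "\<And>x y. x \<in> A \<Longrightarrow> y \<in> A \<Longrightarrow> l x y = k x y" for A k l
      by (rule cong[OF that(1)]) (rule that(2))
    show "?P A (\<lambda>x y. f x)" using start .
  qed (use that in blast)
  show thesis
  proof (rule that[of B "\<lambda>x. l x x"])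
    show "A \<subseteq> B" "P B (\<lambda>x. l x x)" by fact+
    show "l x x = f x" if "x \<in> A" for x using B(3) that by blast
    fix C h assume C: "B \<subseteq> C" "P C h" "\<And>x. x \<in> B \<Longrightarrow> h x = l x x"
    let ?m = "\<lambda>x y. if x \<in> B \<and> y \<in> B then l x y else h x"
    show "C = B"
    proof (rule max[of C ?m, OF C(1)])
      show "P C (\<lambda>x. ?m x x)" by (rule cong[OF C(2)]) (use C(3) in auto)
    qed simp
  qed
qed

section \<open>Limits of finite metric spaces\<close>

lemma tendsto_pointwise2:
  fixes d :: "nat \<Rightarrow> 'a \<Rightarrow> 'b \<Rightarrow> real"
  shows "d \<longlonglongrightarrow> D \<longleftrightarrow> (\<forall>x y. (\<lambda>i. d i x y) \<longlonglongrightarrow> D x y)"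
proof -
  have comp: "f \<longlonglongrightarrow> l \<longleftrightarrow> (\<forall>x. (\<lambda>i. f i x) \<longlonglongrightarrow> l x)"
    for f :: "nat \<Rightarrow> 'c \<Rightarrow> 'd::topological_space" and l
    using limitin_componentwise[of "\<lambda>_. euclidean" UNIV f l sequentially]
    by (simp add: euclidean_product_topology)
  show ?thesis unfolding comp[of d D] comp[of "\<lambda>i. d i x" "D x" for x] ..
qed

text \<open>The index sets are countable, so the topology of pointwise convergence is first countable and closed
  sets can be tested with sequences.\<close>

lemma closedin_metrics_sequential:
  fixes S :: "(nat \<Rightarrow> nat \<Rightarrow> real) set"
  shows "closedin (top_of_set T) S \<longleftrightarrow>
    S \<subseteq> T \<and> (\<forall>d D. (\<forall>i. d i \<in> S) \<longrightarrow> D \<in> T \<longrightarrow> (\<forall>x y. (\<lambda>i. d i x y) \<longlonglongrightarrow> D x y) \<longrightarrow> D \<in> S)"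
    (is "_ \<longleftrightarrow> _ \<and> ?seq")
proof
  assume cl: "closedin (top_of_set T) S"
  then obtain U where U: "closed U" "S = T \<inter> U" unfolding closedin_closed by blast
  have "D \<in> S" if "\<forall>i. d i \<in> S" "D \<in> T" "\<forall>x y. (\<lambda>i. d i x y) \<longlonglongrightarrow> D x y" for d D
  proof -
    have "d \<longlonglongrightarrow> D" using that(3) unfolding tendsto_pointwise2 .
    moreover have "d i \<in> U" for i using that(1) U(2) by blast
    ultimately have "D \<in> U" using closed_sequentially[OF U(1)] by blast
    then show ?thesis using U(2) that(2) by blast
  qed
  then show "S \<subseteq> T \<and> ?seq" using U(2) by blast
next
  assume R: "S \<subseteq> T \<and> ?seq"
  show "closedin (top_of_set T) S" unfolding closedin_limpt
  proof (intro conjI allI impI)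
    show "S \<subseteq> T" using R by (rule conjunct1)
    fix D assume D: "D islimpt S \<and> D \<in> T"
    then obtain d where d: "\<And>i. d i \<in> S - {D}" "d \<longlonglongrightarrow> D"
      unfolding islimpt_sequential by blast
    have "\<forall>x y. (\<lambda>i. d i x y) \<longlonglongrightarrow> D x y" using d(2) unfolding tendsto_pointwise2 .
    then show "D \<in> S" using R d(1) D by blast
  qed
qed

lemma closedin_metricsD:
  fixes S :: "(nat \<Rightarrow> nat \<Rightarrow> real) set"
  assumes "closedin (top_of_set T) S" "\<And>i. d i \<in> S" "D \<in> T"
    "\<And>x y. (\<lambda>i. d i x y) \<longlonglongrightarrow> D x y"
  shows "D \<in> S"
  using assms unfolding closedin_metrics_sequential by blast

lemma metrics_on_iff:
  "d \<in> metrics_on n \<longleftrightarrow>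
     metric_gec {1..n} d \<and> (\<forall>x y. x \<notin> {1..n} \<or> y \<notin> {1..n} \<longrightarrow> d x y = 0)"
proof
  assume "d \<in> metrics_on n"
  then show "metric_gec {1..n} d \<and> (\<forall>x y. x \<notin> {1..n} \<or> y \<notin> {1..n} \<longrightarrow> d x y = 0)"
    unfolding metrics_on_def using Metric_space_metric_gec by blast
next
  assume R: "metric_gec {1..n} d \<and> (\<forall>x y. x \<notin> {1..n} \<or> y \<notin> {1..n} \<longrightarrow> d x y = 0)"
  then have m: "metric_gec {1..n} d" and z: "x \<notin> {1..n} \<or> y \<notin> {1..n} \<Longrightarrow> d x y = 0" for x y
    by blast+
  have "Metric_space {1..n} d"
  proof
    show "0 \<le> d x y" for x y
      using metric_gecD(1)[OF m, of x y] z[of x y] by (cases "x \<in> {1..n} \<and> y \<in> {1..n}") auto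
    show "d x y = d y x" for x y
      using metric_gecD(2)[OF m, of y x] z[of x y] z[of y x]
      by (cases "x \<in> {1..n} \<and> y \<in> {1..n}") auto
    show "d x y = 0 \<longleftrightarrow> x = y" if "x \<in> {1..n}" "y \<in> {1..n}" for x y
      using metric_gecD(3)[OF m that] .
    show "d x z \<le> d x y + d y z" if "x \<in> {1..n}" "y \<in> {1..n}" "z \<in> {1..n}" for x y z
      using metric_gecD(4)[OF m that] .
  qed
  then show "d \<in> metrics_on n" using R unfolding metrics_on_def by blast
qed

definition bounded_layers_closed :: "real gec_class \<Rightarrow> real \<Rightarrow> bool" where
  "bounded_layers_closed F r \<longleftrightarrow>
     (\<forall>n>0. closedin (top_of_set (metrics_on n)) (bounded_metrics_in F r n))"

lemma bounded_metrics_in_mem: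
  "d \<in> bounded_metrics_in F r n \<longleftrightarrow>
     d \<in> metrics_on n \<and> ({1..n}, d) \<in> F \<and> (\<forall>i\<in>{1..n}. \<forall>j\<in>{1..n}. d i j \<le> r)"
  unfolding bounded_metrics_in_def metrics_in_def by blast

text \<open>A convergent sequence of metrics on a finite set is eventually bounded by a constant above its limit,
  so closedness of a layer can be tested on its bounded parts. For \<open>n = 1\<close> the layer has at
  most one element.\<close>

lemma layer_closed_iff_bounded:
  "layer_closed F \<longleftrightarrow> (\<forall>r>0. bounded_layers_closed F r)"
proof
  assume L: "layer_closed F"
  show "\<forall>r>0. bounded_layers_closed F r" unfolding bounded_layers_closed_def
  proof (intro allI impI)
    fix r :: real and n :: nat assume "0 < r" "0 < n"
    show "closedin (top_of_set (metrics_on n)) (bounded_metrics_in F r n)"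
      unfolding closedin_metrics_sequential
    proof (intro conjI allI impI)
      show "bounded_metrics_in F r n \<subseteq> metrics_on n" using bounded_metrics_in_mem by blast
      fix d D assume d: "\<forall>i. d i \<in> bounded_metrics_in F r n" and D: "D \<in> metrics_on n"
        and lim: "\<forall>x y. (\<lambda>i. d i x y) \<longlonglongrightarrow> D x y"
      show "D \<in> bounded_metrics_in F r n"
      proof (cases "n > 1")
        case True
        then have cl: "closedin (top_of_set (metrics_on n)) (metrics_in F n)"
          using L unfolding layer_closed_def by blast
        have "d i \<in> metrics_in F n" for i using d unfolding bounded_metrics_in_def by blast
        then have "D \<in> metrics_in F n" using closedin_metricsD[OF cl _ D] lim by blast
        moreover have "D i j \<le> r" if "i \<in> {1..n}" "j \<in> {1..n}" for i j
        proof (rule LIMSEQ_le_const2)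
          show "(\<lambda>m. d m i j) \<longlonglongrightarrow> D i j" using lim by blast
          show "\<exists>N. \<forall>m\<ge>N. d m i j \<le> r" using d that unfolding bounded_metrics_in_mem by blast
        qed
        ultimately show ?thesis unfolding bounded_metrics_in_def by blast
      next
        case False
        with \<open>0 < n\<close> have n: "n = 1" by simp
        have "D' x y = 0" if D': "D' \<in> metrics_on n" for D' x y
        proof (cases "x \<in> {1..n} \<and> y \<in> {1..n}")
          case True
          then have "x = y" using n by auto
          then show ?thesis using metric_gecD(3)[of "{1..n}" D' x y] D' True
            unfolding metrics_on_iff by blast
        next
          case False
          then show ?thesis using D' unfolding metrics_on_iff by blast
        qed
        moreover have "d 0 \<in> metrics_on n" using d bounded_metrics_in_mem by blast
        ultimately have "D = d 0" using D by (intro ext) metis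
        then show ?thesis using d by blast
      qed
    qed
  qed
next
  assume R: "\<forall>r>0. bounded_layers_closed F r"
  show "layer_closed F" unfolding layer_closed_def
  proof (intro allI impI)
    fix n :: nat assume n: "1 < n"
    show "closedin (top_of_set (metrics_on n)) (metrics_in F n)"
      unfolding closedin_metrics_sequential
    proof (intro conjI allI impI)
      show "metrics_in F n \<subseteq> metrics_on n" unfolding metrics_in_def by blast
      fix d D assume d: "\<forall>i. d i \<in> metrics_in F n" and D: "D \<in> metrics_on n"
        and lim: "\<forall>x y. (\<lambda>i. d i x y) \<longlonglongrightarrow> D x y"
      define r where "r = 1 + (\<Sum>x\<in>{1..n}. \<Sum>y\<in>{1..n}. \<bar>D x y\<bar>)"
      have r: "D x y < r" if "x \<in> {1..n}" "y \<in> {1..n}" for x y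
      proof -
        have "\<bar>D x y\<bar> \<le> (\<Sum>y\<in>{1..n}. \<bar>D x y\<bar>)" by (rule member_le_sum) (use that in auto)
        also have "\<dots> \<le> (\<Sum>x\<in>{1..n}. \<Sum>y\<in>{1..n}. \<bar>D x y\<bar>)"
          by (rule member_le_sum[of _ _ "\<lambda>x. \<Sum>y\<in>{1..n}. \<bar>D x y\<bar>"]) (use that in \<open>auto intro: sum_nonneg\<close>)
        finally show ?thesis unfolding r_def by linarith
      qed
      have "0 < r" unfolding r_def by (intro add_pos_nonneg sum_nonneg) auto
      have "\<forall>\<^sub>F i in sequentially. \<forall>x\<in>{1..n}. \<forall>y\<in>{1..n}. d i x y < r"
        by (intro eventually_ball_finite ballI order_tendstoD(2)[OF lim[rule_format] r]) auto
      then obtain N where N: "\<And>i. i \<ge> N \<Longrightarrow> \<forall>x\<in>{1..n}. \<forall>y\<in>{1..n}. d i x y < r"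
        unfolding eventually_sequentially by blast
      have cl: "closedin (top_of_set (metrics_on n)) (bounded_metrics_in F r n)"
        using R \<open>0 < r\<close> n unfolding bounded_layers_closed_def by simp
      have "D \<in> bounded_metrics_in F r n"
      proof (rule closedin_metricsD[OF cl _ D])
        fix i
        have "d (i + N) x y \<le> r" if "x \<in> {1..n}" "y \<in> {1..n}" for x y
          using bspec[OF bspec[OF N[of "i + N"] that(1)] that(2)] by simp
        then show "d (i + N) \<in> bounded_metrics_in F r n"
          using d unfolding bounded_metrics_in_def by blast
      next
        show "(\<lambda>i. d (i + N) x y) \<longlonglongrightarrow> D x y" for x y
          using lim by (intro LIMSEQ_ignore_initial_segment) blast
      qed
      then show "D \<in> metrics_in F n" unfolding bounded_metrics_in_def by blast
    qed
  qed
qed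

lemma metric_gec_limit:
  assumes m: "\<And>i::nat. metric_gec V (k i)"
    and lim: "\<And>x y. x \<in> V \<Longrightarrow> y \<in> V \<Longrightarrow> (\<lambda>i. k i x y) \<longlonglongrightarrow> K x y"
    and ne: "\<And>x y. x \<in> V \<Longrightarrow> y \<in> V \<Longrightarrow> x \<noteq> y \<Longrightarrow> K x y \<noteq> 0"
  shows "metric_gec V K"
proof (rule metric_gecI)
  fix x y assume xy: "x \<in> V" "y \<in> V"
  show "0 \<le> K x y"
    by (rule LIMSEQ_le_const[OF lim[OF xy]]) (use metric_gecD(1)[OF m xy] in blast)
  have "k i y x = k i x y" for i by (rule metric_gecD(2)[OF m xy])
  then have "(\<lambda>i. k i x y) \<longlonglongrightarrow> K y x" using lim[OF xy(2,1)] by simp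
  then show "K y x = K x y" by (rule LIMSEQ_unique) (rule lim[OF xy])
  show "K x y = 0 \<longleftrightarrow> x = y"
  proof
    show "K x y = 0 \<Longrightarrow> x = y" using ne[OF xy] by blast
    assume "x = y"
    then have "(\<lambda>i. 0) \<longlonglongrightarrow> K x y" using lim[OF xy] metric_gecD(3)[OF m xy] by simp
    then show "K x y = 0" by (simp add: LIMSEQ_const_iff)
  qed
  fix z assume z: "z \<in> V"
  show "K x z \<le> K x y + K y z"
    by (rule LIMSEQ_le[OF lim[OF xy(1) z] tendsto_add[OF lim[OF xy] lim[OF xy(2) z]]])
      (use metric_gecD(4)[OF m xy z] in blast)
qed

text \<open>A layer consists of metrics on a fixed index set; enumerating a finite space transports its
  closedness to every finite carrier.\<close>

lemma age_in_limit_bounded: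
  assumes F: "finitary_structure F" "\<forall>(V, d)\<in>F. metric_gec V d" and cl: "bounded_layers_closed F r"
    and V: "finite V" and age: "\<And>i::nat. age_in F V (k i)"
    and bd: "\<And>i x y. x \<in> V \<Longrightarrow> y \<in> V \<Longrightarrow> k i x y \<le> r"
    and lim: "\<And>x y. x \<in> V \<Longrightarrow> y \<in> V \<Longrightarrow> (\<lambda>i. k i x y) \<longlonglongrightarrow> K x y"
    and ne: "\<And>x y. x \<in> V \<Longrightarrow> y \<in> V \<Longrightarrow> x \<noteq> y \<Longrightarrow> K x y \<noteq> 0"
  shows "age_in F V K"
proof (cases "V = {}")
  case True
  then show ?thesis using age_in_cong[OF age[of 0]] by blast
next
  case False
  define n where "n = card V"
  have n: "n > 0" using False V unfolding n_def by (simp add: card_gt_0_iff)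
  obtain e where e: "bij_betw e {1..n} V"
    using ex_bij_betw_nat_finite_1[OF V] unfolding n_def by blast
  define p where "p l i j = (if i \<in> {1..n} \<and> j \<in> {1..n} then l (e i) (e j) else 0)"
    for l :: "_ \<Rightarrow> _ \<Rightarrow> real" and i j
  have eV: "e i \<in> V" if "i \<in> {1..n}" for i using e that unfolding bij_betw_def by blast
  have inj: "inj_on e {1..n}" and surj: "e ` {1..n} = V" using e unfolding bij_betw_def by blast+
  have pm: "partial_morphism {1..n} (p l) V l {1..n} e" for l
    by (rule partial_morphismI) (use eV in \<open>auto simp: p_def\<close>)
  have on: "p l \<in> metrics_on n" if "metric_gec V l" for l
  proof -
    have "metric_gec {1..n} (p l)" by (rule metric_gec_pullback[OF that pm inj])
    moreover have "\<forall>x y. x \<notin> {1..n} \<or> y \<notin> {1..n} \<longrightarrow> p l x y = 0" unfolding p_def by auto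
    ultimately show ?thesis unfolding metrics_on_iff by blast
  qed
  have mk: "metric_gec V (k i)" for i by (rule age_in_metric_class[OF F(2) age])
  have mK: "metric_gec V K" by (rule metric_gec_limit[OF mk lim ne])
  have "closedin (top_of_set (metrics_on n)) (bounded_metrics_in F r n)"
    using cl n unfolding bounded_layers_closed_def by blast
  then have "p K \<in> bounded_metrics_in F r n"
  proof (rule closedin_metricsD)
    show "p K \<in> metrics_on n" by (rule on[OF mK])
    show "(\<lambda>i. p (k i) x y) \<longlonglongrightarrow> p K x y" for x y
    proof (cases "x \<in> {1..n} \<and> y \<in> {1..n}")
      case True
      then show ?thesis unfolding p_def using lim[OF eV eV, of x y] by simp
    qed (auto simp: p_def)
    fix i
    have "age_in F {1..n} (p (k i))"
      by (rule age_in_pullback[OF age _ pm])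
        (rule metric_gec_is_gec[OF metric_gec_pullback[OF mk pm inj]])
    then have "({1..n}, p (k i)) \<in> F"
      using finitary_mem_iff_age_in[OF F(1), of "{1..n}"] n by simp
    moreover have "p (k i) x y \<le> r" if "x \<in> {1..n}" "y \<in> {1..n}" for x y
      unfolding p_def using bd[OF eV[OF that(1)] eV[OF that(2)]] that by simp
    ultimately show "p (k i) \<in> bounded_metrics_in F r n"
      unfolding bounded_metrics_in_mem using on[OF mk] by blast
  qed
  then have "({1..n}, p K) \<in> F" unfolding bounded_metrics_in_mem by blast
  then have "age_in F {1..n} (p K)" using finitary_mem_iff_age_in[OF F(1), of "{1..n}"] n by simp
  moreover have "partial_morphism V K {1..n} (p K) V (inv_into {1..n} e)"
    using partial_morphism_inv[OF pm inj] unfolding surj .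
  ultimately show ?thesis using age_in_pullback metric_gec_is_gec[OF mK] by blast
qed

lemma age_in_limit:
  assumes F: "finitary_structure F" "\<forall>(V, d)\<in>F. metric_gec V d" and cl: "layer_closed F"
    and V: "finite V" and age: "\<And>i::nat. age_in F V (k i)"
    and lim: "\<And>x y. x \<in> V \<Longrightarrow> y \<in> V \<Longrightarrow> (\<lambda>i. k i x y) \<longlonglongrightarrow> K x y"
    and ne: "\<And>x y. x \<in> V \<Longrightarrow> y \<in> V \<Longrightarrow> x \<noteq> y \<Longrightarrow> K x y \<noteq> 0"
  shows "age_in F V K"
proof -
  have "\<exists>B. \<forall>i. \<bar>k i x y\<bar> \<le> B" if "x \<in> V" "y \<in> V" for x y
  proof -
    have "Bseq (\<lambda>i. k i x y)" using convergent_imp_Bseq convergentI lim[OF that] by blast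
    then show ?thesis unfolding Bseq_def by auto
  qed
  then obtain B where B: "\<And>i x y. x \<in> V \<Longrightarrow> y \<in> V \<Longrightarrow> \<bar>k i x y\<bar> \<le> B x y" by metis
  define r where "r = 1 + (\<Sum>x\<in>V. \<Sum>y\<in>V. \<bar>B x y\<bar>)"
  have "k i x y \<le> r" if "x \<in> V" "y \<in> V" for i x y
  proof -
    have "k i x y \<le> \<bar>B x y\<bar>" using B[OF that, of i] by linarith
    also have "\<dots> \<le> (\<Sum>y\<in>V. \<bar>B x y\<bar>)" by (rule member_le_sum) (use that V in auto)
    also have "\<dots> \<le> (\<Sum>x\<in>V. \<Sum>y\<in>V. \<bar>B x y\<bar>)"
      by (rule member_le_sum[of _ _ "\<lambda>x. \<Sum>y\<in>V. \<bar>B x y\<bar>"]) (use that V in \<open>auto intro: sum_nonneg\<close>)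
    finally show ?thesis unfolding r_def by linarith
  qed
  moreover have "0 < r" unfolding r_def by (intro add_pos_nonneg sum_nonneg) auto
  then have "bounded_layers_closed F r" using cl unfolding layer_closed_iff_bounded by blast
  ultimately show ?thesis using age_in_limit_bounded[OF F _ V age _ lim ne] by blast
qed

section \<open>Amalgamation over arbitrary sets\<close>

lemma fill_in_simps:
  "fill_in a b k c a b = c" "fill_in a b k c b a = c"
  "\<not> (x = a \<and> y = b) \<Longrightarrow> \<not> (x = b \<and> y = a) \<Longrightarrow> fill_in a b k c x y = k x y"
  unfolding fill_in_def by auto

lemma completion_color_bounds:
  assumes m: "metric_gec V (fill_in a b k c)" and ab: "a \<in> V" "b \<in> V" "a \<noteq> b" and v: "v \<in> V - {a, b}"
  shows "\<bar>k a v - k b v\<bar> \<le> c" "c \<le> k a v + k b v"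
proof -
  let ?k = "fill_in a b k c"
  have v': "v \<in> V" "v \<noteq> a" "v \<noteq> b" using v by auto
  have 1: "?k a v \<le> ?k a b + ?k b v" "?k b v \<le> ?k b a + ?k a v" "?k a b \<le> ?k a v + ?k v b"
    by (rule metric_gecD(4)[OF m]; use ab v' in simp)+
  have "?k v b = ?k b v" by (rule metric_gecD(2)[OF m ab(2) v'(1)])
  moreover have "?k a v = k a v" "?k b v = k b v" using v' ab by (simp_all add: fill_in_simps(3))
  ultimately show "\<bar>k a v - k b v\<bar> \<le> c" "c \<le> k a v + k b v"
    using 1 unfolding fill_in_simps(1,2) by linarith+
qed

text \<open>A limit of completing colours yields a limit of members of \<open>F\<close>, and this limit is a metric: by
  asymmetry at \<open>v\<close> the triangle inequality keeps the colours away from \<open>0\<close>.\<close>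

lemma closed_completion_colors:
  assumes F: "finitary_structure F" "\<forall>(V, d)\<in>F. metric_gec V d" and cl: "layer_closed F"
    and V: "finite V" and ab: "a \<in> V" "b \<in> V" "a \<noteq> b"
    and v: "v \<in> V - {a, b}" "k a v \<noteq> k b v"
  shows "closed {c. age_in F V (fill_in a b k c)}"
  unfolding closed_sequential_limits
proof clarify
  fix c C assume c: "\<forall>i::nat. c i \<in> {c. age_in F V (fill_in a b k c)}" and lim: "c \<longlonglongrightarrow> C"
  then have age: "age_in F V (fill_in a b k (c i))" for i by blast
  note m = age_in_metric_class[OF F(2) age]
  have "\<bar>k a v - k b v\<bar> \<le> C"
    by (rule LIMSEQ_le_const[OF lim]) (use completion_color_bounds(1)[OF m ab v(1)] in blast)
  then have "C \<noteq> 0" using v(2) by linarith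
  show "age_in F V (fill_in a b k C)"
  proof (rule age_in_limit[OF F cl V age])
    fix x y assume xy: "x \<in> V" "y \<in> V"
    show "(\<lambda>i. fill_in a b k (c i) x y) \<longlonglongrightarrow> fill_in a b k C x y"
      unfolding fill_in_def using lim by auto
    assume "x \<noteq> y"
    then have "fill_in a b k (c 0) x y \<noteq> 0" using metric_gecD(3)[OF m xy] by blast
    then show "fill_in a b k C x y \<noteq> 0" using \<open>C \<noteq> 0\<close> unfolding fill_in_def by presburger
  qed
qed

text \<open>Any admissible pair avoids \<open>a\<close> or avoids \<open>b\<close>, so each condition can be read off one of the two
  metric subspaces, which share the pseudocolor \<open>0\<close>.\<close>

lemma metric_incomplete_gec:
  assumes ma: "metric_gec (V - {a}) k" and mb: "metric_gec (V - {b}) k"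
    and ab: "a \<in> V" "b \<in> V" "a \<noteq> b"
  shows "incomplete_gec V a b k"
proof -
  have zero: "k z z = 0" if "z \<in> V" for z
    using metric_gecD(3)[OF ma, of z z] metric_gecD(3)[OF mb, of z z] that ab by blast
  have side: "x \<in> V - {a} \<and> y \<in> V - {a} \<or> x \<in> V - {b} \<and> y \<in> V - {b}"
    if "x \<in> V" "y \<in> V" "(x, y) \<notin> {(a, b), (b, a)}" for x y
    using that ab by blast
  have "k x y = k z z \<longleftrightarrow> x = y" if "x \<in> V" "y \<in> V" "z \<in> V" "(x, y) \<notin> {(a, b), (b, a)}" for x y z
    unfolding zero[OF that(3)]
    using side[OF that(1,2,4)] metric_gecD(3)[OF ma, of x y] metric_gecD(3)[OF mb, of x y] by argo
  moreover have "k y x = k x y" if "x \<in> V" "y \<in> V" "(x, y) \<notin> {(a, b), (b, a)}" for x y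
    using side[OF that] metric_gecD(2)[OF ma, of x y] metric_gecD(2)[OF mb, of x y] by argo
  ultimately show ?thesis unfolding incomplete_gec_def using ab by (intro conjI ballI impI)
qed

text \<open>AP is a statement about carriers in \<^typ>\<open>nat\<close>; an injective numbering transports it to any finite set.\<close>

lemma finite_amalgamation:
  assumes F: "finitary_structure F" "\<forall>(V, d)\<in>F. metric_gec V d" and AP: "has_AP F"
    and V: "finite V" and ab: "a \<in> V" "b \<in> V" "a \<noteq> b"
    and v: "v \<in> V - {a, b}" "k a v \<noteq> k b v"
    and a: "age_in F (V - {a}) k" and b: "age_in F (V - {b}) k"
  obtains c where "age_in F V (fill_in a b k c)"
proof -
  obtain e :: "_ \<Rightarrow> nat" where e: "inj_on e V"
    using finite_imp_inj_to_nat_seg[OF V] by blast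
  define h where "h = inv_into V e"
  have he: "h (e x) = x" if "x \<in> V" for x using e that unfolding h_def by simp
  define l where "l i j = k (h i) (h j)" for i j
  have side: "(e ` V - {e u}, l) \<in> F" if u: "u \<in> V" "age_in F (V - {u}) k" "v \<noteq> u" for u
  proof -
    have eq: "e ` V - {e u} = e ` (V - {u})" using e u(1) unfolding inj_on_def by blast
    have pm: "partial_morphism (e ` (V - {u})) l (V - {u}) k (e ` (V - {u})) h"
      by (rule partial_morphismI) (use he in \<open>auto simp: l_def\<close>)
    have inj: "inj_on h (e ` (V - {u}))" by (rule inj_onI) (use he in auto)
    have "age_in F (e ` (V - {u})) l"
      by (rule age_in_pullback[OF u(2) is_gec_pullback[OF age_in_is_gec[OF u(2)] pm inj] pm])
    moreover have "finite (e ` (V - {u}))" "e ` (V - {u}) \<noteq> {}" using V v(1) u(3) by auto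
    ultimately show ?thesis unfolding eq using finitary_mem_iff_age_in[OF F(1)] by blast
  qed
  have aff: "affiliated F (e ` V) (e a) (e b) l"
    unfolding affiliated_def using side[OF ab(1) a] side[OF ab(2) b] v(1) by blast
  have "e a \<noteq> e b" using e ab unfolding inj_on_def by blast
  have "incomplete_gec (e ` V) (e a) (e b) l"
  proof (rule metric_incomplete_gec)
    show "metric_gec (e ` V - {e a}) l" "metric_gec (e ` V - {e b}) l"
      using aff F(2) unfolding affiliated_def by blast+
  qed (use ab \<open>e a \<noteq> e b\<close> in auto)
  moreover have "non_symmetric (e ` V) (e a) (e b) l"
    unfolding non_symmetric_def
  proof (rule bexI)
    show "l (e a) (e v) \<noteq> l (e b) (e v)" using v he ab unfolding l_def by simp
    show "e v \<in> e ` V - {e a, e b}" using v(1) ab e unfolding inj_on_def by blast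
  qed
  ultimately obtain c where c: "(e ` V, fill_in (e a) (e b) l c) \<in> F"
    using AP aff unfolding has_AP_def Delta_def by blast
  have pm: "partial_morphism V (fill_in a b k c) (e ` V) (fill_in (e a) (e b) l c) V e"
  proof (rule partial_morphismI)
    fix x y assume xy: "x \<in> V" "y \<in> V"
    then show "fill_in a b k c x y = fill_in (e a) (e b) l c (e x) (e y)"
      using he ab inj_on_eq_iff[OF e] unfolding fill_in_def l_def by auto
  qed auto
  have age: "age_in F (e ` V) (fill_in (e a) (e b) l c)"
    using c finitary_mem_iff_age_in[OF F(1), of "e ` V"] V ab by blast
  show thesis
    by (rule that, rule age_in_pullback[OF age is_gec_pullback[OF age_in_is_gec[OF age] pm e] pm])
qed

text \<open>For every finite \<open>S \<subseteq> B\<close> containing the witness \<open>v\<close>, the completing colours over \<open>S\<close> form a non-empty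
  closed set in the interval from \<open>0\<close> to \<open>k a v + k b v\<close>. These sets decrease as \<open>S\<close> grows, so by compactness some colour
  works for all \<open>S\<close> at once, and hence over \<open>B\<close>.\<close>

lemma amalgamation:
  assumes F: "finitary_structure F" "\<forall>(V, d)\<in>F. metric_gec V d" and cl: "layer_closed F"
    and AP: "has_AP F" and ab: "a \<notin> B" "b \<notin> B" "a \<noteq> b" and v: "v \<in> B" "k a v \<noteq> k b v"
    and a: "age_in F (insert a B) k" and b: "age_in F (insert b B) k"
  obtains c where "age_in F (insert a (insert b B)) (fill_in a b k c)"
proof -
  define D where "D S = {c. age_in F (insert a (insert b S)) (fill_in a b k c)}" for S
  define I where "I = {S. finite S \<and> S \<subseteq> B \<and> v \<in> S}"
  have IV: "finite (insert a (insert b S))" "v \<in> insert a (insert b S) - {a, b}" if "S \<in> I" for S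
    using that v(1) ab unfolding I_def by auto
  have nonempty: "D S \<noteq> {}" if S: "S \<in> I" for S
  proof -
    have eq: "insert a (insert b S) - {a} = insert b S" "insert a (insert b S) - {b} = insert a S"
      using S ab unfolding I_def by auto
    have sub: "insert a S \<subseteq> insert a B" "insert b S \<subseteq> insert b B" using S unfolding I_def by auto
    obtain c where "age_in F (insert a (insert b S)) (fill_in a b k c)"
    proof (rule finite_amalgamation[where k = k, OF F AP IV(1)[OF S] _ _ ab(3) IV(2)[OF S] v(2)])
      show "age_in F (insert a (insert b S) - {a}) k" "age_in F (insert a (insert b S) - {b}) k"
        unfolding eq using age_in_subset[OF b sub(2)] age_in_subset[OF a sub(1)] .
    qed auto
    then show ?thesis unfolding D_def by blast
  qed
  have bound: "D S \<subseteq> {0..k a v + k b v}" if S: "S \<in> I" for S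
  proof
    fix c assume "c \<in> D S"
    then have m: "metric_gec (insert a (insert b S)) (fill_in a b k c)"
      unfolding D_def using age_in_metric_class[OF F(2)] by blast
    from completion_color_bounds[OF m _ _ ab(3) IV(2)[OF S]] show "c \<in> {0..k a v + k b v}" by auto
  qed
  have "{0..k a v + k b v} \<inter> (\<Inter>S\<in>I. D S) \<noteq> {}"
  proof (rule compact_imp_fip_image)
    show "compact {0..k a v + k b v}" by simp
    show "closed (D S)" if "S \<in> I" for S
      unfolding D_def
      by (rule closed_completion_colors[where k = k, OF F cl IV(1)[OF that] _ _ ab(3) IV(2)[OF that] v(2)]) auto
    fix J assume J: "finite J" "J \<subseteq> I"
    \<comment> \<open>The witness \<open>v\<close> is added for the case of an empty family \<open>J\<close>.\<close>
    let ?S = "insert v (\<Union>J)"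
    have S: "?S \<in> I" using J v(1) unfolding I_def by auto
    have "D ?S \<subseteq> D T" if "T \<in> J" for T
      unfolding D_def using that by (auto intro: age_in_subset)
    then show "{0..k a v + k b v} \<inter> (\<Inter>S\<in>J. D S) \<noteq> {}"
      using nonempty[OF S] bound[OF S] by blast
  qed
  then obtain c where c: "\<And>S. S \<in> I \<Longrightarrow> age_in F (insert a (insert b S)) (fill_in a b k c)"
    unfolding D_def by blast
  show thesis
  proof (rule that, rule age_in_finite_character)
    fix T assume T: "T \<subseteq> insert a (insert b B)" "finite T"
    have "insert v (T \<inter> B) \<in> I" using T v(1) unfolding I_def by auto
    from c[OF this] show "age_in F T (fill_in a b k c)" by (rule age_in_subset) (use T in auto)
  qed
qed

section \<open>Saturated spaces are absolutely homogeneous\<close>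

text \<open>The new point is \<^const>\<open>None\<close>, so that it is distinct from all old points whatever their type is.\<close>

definition adjoin :: "('v \<Rightarrow> 'v \<Rightarrow> real) \<Rightarrow> ('v \<Rightarrow> real) \<Rightarrow> 'v option \<Rightarrow> 'v option \<Rightarrow> real" where
  "adjoin k g p q =
     (case p of None \<Rightarrow> (case q of None \<Rightarrow> 0 | Some y \<Rightarrow> g y)
      | Some x \<Rightarrow> (case q of None \<Rightarrow> g x | Some y \<Rightarrow> k x y))"

lemma adjoin_simps [simp]:
  "adjoin k g None None = 0" "adjoin k g None (Some y) = g y" "adjoin k g (Some x) None = g x"
  "adjoin k g (Some x) (Some y) = k x y"
  unfolding adjoin_def by simp_all

definition saturated :: "real gec_class \<Rightarrow> 'v set \<Rightarrow> ('v \<Rightarrow> 'v \<Rightarrow> real) \<Rightarrow> bool" where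
  "saturated F V k \<longleftrightarrow>
     (\<forall>A g. A \<subseteq> V \<and> age_in F (insert None (Some ` A)) (adjoin k g) \<longrightarrow>
        (\<exists>v\<in>V. \<forall>a\<in>A. k v a = g a))"

text \<open>The form in which saturation is used: a partial isometry \<open>h\<close> of an \<open>F\<close>-space into \<open>V\<close> extends by one
  point. The extension is transported along \<open>h\<close> to one of \<open>h ` B\<close>.\<close>

lemma saturated_realizes:
  assumes F: "\<forall>(V, d)\<in>F. metric_gec V d"
    and sat: "saturated F V k" and kV: "age_in F V k"
    and l: "age_in F (insert x B) l" and h: "partial_morphism B l V k B h"
  shows "\<exists>v\<in>V. \<forall>b\<in>B. k v (h b) = l x b"
proof (cases "x \<in> B")
  case True
  have "k (h x) (h b) = l x b" if "b \<in> B" for b using partial_morphismD(3)[OF h True that] by simp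
  then show ?thesis using partial_morphismD(2)[OF h True] by (intro bexI[of _ "h x"]) simp_all
next
  case False
  have lm: "metric_gec (insert x B) l" by (rule age_in_metric_class[OF F l])
  have inj: "inj_on h B"
    by (rule partial_morphism_inj_on[OF is_gec_subset[OF age_in_is_gec[OF l]] age_in_is_gec[OF kV] h]) blast
  let ?g = "\<lambda>w. l x (inv_into B h w)"
  let ?f = "\<lambda>p. case p of None \<Rightarrow> x | Some w \<Rightarrow> inv_into B h w"
  let ?U = "insert None (Some ` h ` B)"
  have pm: "partial_morphism ?U (adjoin k ?g) (insert x B) l ?U ?f"
  proof (rule partial_morphismI)
    fix p q assume p: "p \<in> ?U" and q: "q \<in> ?U"
    from p show "?f p \<in> insert x B" using inj by auto
    have 0: "l x x = 0" using metric_gecD(3)[OF lm] by blast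
    have sym: "l b x = l x b" if "b \<in> B" for b using metric_gecD(2)[OF lm, of x b] that by blast
    from p q show "adjoin k ?g p q = l (?f p) (?f q)"
      using inj 0 sym partial_morphismD(3)[OF h] by auto
  qed simp
  have "inj_on ?f ?U" using inj False by (auto simp: inj_on_def)
  then have "age_in F ?U (adjoin k ?g)"
    using age_in_pullback[OF l is_gec_pullback[OF age_in_is_gec[OF l] pm] pm] by blast
  moreover have "h ` B \<subseteq> V" using partial_morphismD(2)[OF h] by blast
  ultimately obtain v where "v \<in> V" "\<forall>a\<in>h ` B. k v a = ?g a"
    using sat unfolding saturated_def by blast
  then show ?thesis using inj by (intro bexI[of _ v]) simp_all
qed

lemma partial_morphism_fun_upd:
  assumes g: "partial_morphism V k V k B g" and v: "v \<in> V" "u \<in> V" "v \<notin> B"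
    and m: "metric_gec V k" and d: "\<And>b. b \<in> B \<Longrightarrow> k u (g b) = k v b"
  shows "partial_morphism V k V k (insert v B) (g(v := u))"
proof (rule partial_morphismI)
  show "insert v B \<subseteq> V" using v partial_morphismD(1)[OF g] by blast
  fix x assume x: "x \<in> insert v B"
  then show "(g(v := u)) x \<in> V" using v partial_morphismD(2)[OF g] by auto
  fix y assume y: "y \<in> insert v B"
  have 0: "k v v = 0" "k u u = 0" using metric_gecD(3)[OF m] v by blast+
  have s: "k b v = k (g b) u" if "b \<in> B" for b
    using d[OF that] metric_gecD(2)[OF m v(1) partial_morphismD(1)[OF g that]]
      metric_gecD(2)[OF m v(2) partial_morphismD(2)[OF g that]] by simp
  show "k x y = k ((g(v := u)) x) ((g(v := u)) y)"
  proof (cases "x = v")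
    case True
    then show ?thesis using y d[of y] 0 v(3) by (cases "y = v") auto
  next
    case False
    then have "x \<in> B" using x by blast
    then show ?thesis using False y s[of x] partial_morphismD(3)[OF g, of x y] by (cases "y = v") auto
  qed
qed

text \<open>One half of a back-and-forth argument suffices once the partial isometry is maximal: saturation
  makes it total, and then surjective as well. Indeed, the distances from a point \<open>u\<close> to the range, read as
  distances to the points of \<open>V\<close>, are those of some \<open>v \<in> V\<close>, and so \<open>u\<close> is at distance \<open>0\<close> from \<open>g v\<close>.\<close>

lemma saturated_ab_ho:
  assumes F: "\<forall>(V, d)\<in>F. metric_gec V d" and sat: "saturated F V k" and kV: "age_in F V k"
  shows "ab_ho V k"
  unfolding ab_ho_def
proof (intro conjI allI impI)
  note m = age_in_metric_class[OF F kV]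
  show "is_gec V k" using kV by (rule age_in_is_gec)
  fix A f assume f: "partial_morphism V k V k A f"
  obtain B g where B: "A \<subseteq> B" "partial_morphism V k V k B g" "\<And>x. x \<in> A \<Longrightarrow> g x = f x"
    and max: "\<And>C h. B \<subseteq> C \<Longrightarrow> partial_morphism V k V k C h \<Longrightarrow>
      (\<And>x. x \<in> B \<Longrightarrow> h x = g x) \<Longrightarrow> C = B"
  proof (rule maximal_extension_fun[of "partial_morphism V k V k" A f])
    show "partial_morphism V k V k B f" if "partial_morphism V k V k A f" "B \<subseteq> A" for A B f
      using partial_morphism_subset that by blast
    show "partial_morphism V k V k A f"
      if S: "\<And>S. S \<subseteq> A \<Longrightarrow> finite S \<Longrightarrow> partial_morphism V k V k S f" for A f
    proof (rule partial_morphismI)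
      show "A \<subseteq> V"
      proof
        fix x assume "x \<in> A"
        then show "x \<in> V" using partial_morphismD(1)[OF S[of "{x}"], of x] by simp
      qed
      show "f a \<in> V" if "a \<in> A" for a using partial_morphismD(2)[OF S[of "{a}"], of a] that by simp
      show "k a b = k (f a) (f b)" if "a \<in> A" "b \<in> A" for a b
        using partial_morphismD(3)[OF S[of "{a, b}"], of a b] that by simp
    qed
    show "partial_morphism V k V k A g"
      if f: "partial_morphism V k V k A f" and eq: "\<And>x. x \<in> A \<Longrightarrow> g x = f x" for A f g
    proof (rule partial_morphismI)
      show "A \<subseteq> V" using partial_morphismD(1)[OF f] by (rule subsetI)
      show "g a \<in> V" if "a \<in> A" for a using partial_morphismD(2)[OF f that] eq[OF that] by simp
      show "k a b = k (g a) (g b)" if "a \<in> A" "b \<in> A" for a b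
        unfolding eq[OF that(1)] eq[OF that(2)] by (rule partial_morphismD(3)[OF f that])
    qed
    show "partial_morphism V k V k A f" by (rule f)
  qed blast
  have BV: "B = V"
  proof (rule ccontr)
    assume "B \<noteq> V"
    moreover have "B \<subseteq> V" using partial_morphismD(1)[OF B(2)] by blast
    ultimately obtain v where v: "v \<in> V" "v \<notin> B" by blast
    have vB: "age_in F (insert v B) k" using \<open>B \<subseteq> V\<close> v by (intro age_in_subset[OF kV]) auto
    have gB: "partial_morphism B k V k B g"
      by (rule partial_morphismI[OF subset_refl])
        (rule partial_morphismD[OF B(2)], assumption+)+
    obtain u where u: "u \<in> V" "\<And>b. b \<in> B \<Longrightarrow> k u (g b) = k v b"
      using saturated_realizes[OF F sat kV vB gB] by blast
    have "insert v B = B"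
      by (rule max[OF _ partial_morphism_fun_upd[OF B(2) v(1) u(1) v(2) m u(2)]]) (use v in auto)
    then show False using v by blast
  qed
  have g: "partial_morphism V k V k V g" using B(2) unfolding BV .
  have inj: "inj_on g V" by (rule partial_morphism_inj_on[OF age_in_is_gec age_in_is_gec g]) fact+
  have "g ` V = V"
  proof
    show gV: "g ` V \<subseteq> V" using partial_morphismD(2)[OF g] by blast
    show "V \<subseteq> g ` V"
    proof
      fix u assume u: "u \<in> V"
      have ug: "age_in F (insert u (g ` V)) k" using u gV by (intro age_in_subset[OF kV]) auto
      have inv: "partial_morphism (g ` V) k V k (g ` V) (inv_into V g)"
        by (rule partial_morphismI[OF subset_refl])
          (rule partial_morphismD[OF partial_morphism_inv[OF g inj]], assumption+)+
      obtain v where v: "v \<in> V" "\<And>w. w \<in> g ` V \<Longrightarrow> k v (inv_into V g w) = k u w"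
        using saturated_realizes[OF F sat kV ug inv] by blast
      have "k u (g v) = 0" using v(2)[of "g v"] v(1) inj metric_gecD(3)[OF m v(1) v(1)] by simp
      then have "u = g v" using metric_gecD(3)[OF m u] v(1) gV by blast
      then show "u \<in> g ` V" using v(1) by blast
    qed
  qed
  then show "\<exists>g. gec_iso V k V k g \<and> (\<forall>a\<in>A. g a = f a)"
    unfolding gec_iso_def bij_betw_def using g inj B(3) by (intro exI[of _ g]) simp
qed

lemma saturated_skeleton:
  assumes F: "finitary_structure F" "\<forall>(V, d)\<in>F. metric_gec V d"
    and sat: "saturated F V k" and kV: "age_in F V k"
  shows "skeleton V k = F"
proof
  show "skeleton V k \<subseteq> F" using kV unfolding age_in_def by blast
  show "F \<subseteq> skeleton V k"
  proof (rule subrelI)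
    fix W l assume WF: "(W, l) \<in> F"
    note W = finitary_structureD(4,5)[OF F(1) WF]
    have age: "age_in F W l" using WF finitary_mem_iff_age_in[OF F(1) W] by blast
    have lm: "metric_gec W l" by (rule age_in_metric_class[OF F(2) age])
    note m = age_in_metric_class[OF F(2) kV]
    have "\<exists>h. partial_morphism S l V k S h" if "S \<subseteq> W" "finite S" for S
      using that(2,1)
    proof (induction S)
      case empty
      show ?case by (simp add: partial_morphism_def)
    next
      case (insert x S)
      then obtain h where h: "partial_morphism S l V k S h" by blast
      have xS: "age_in F (insert x S) l" by (rule age_in_subset[OF age insert.prems])
      obtain v where v: "v \<in> V" "\<And>b. b \<in> S \<Longrightarrow> k v (h b) = l x b"
        using saturated_realizes[OF F(2) sat kV xS h] by blast
      have "partial_morphism (insert x S) l V k (insert x S) (h(x := v))"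
      proof (rule partial_morphismI)
        fix a assume a: "a \<in> insert x S"
        then show "(h(x := v)) a \<in> V" using v(1) partial_morphismD(2)[OF h] by auto
        fix b assume b: "b \<in> insert x S"
        have x: "x \<in> W" using insert.prems by blast
        have 0: "l x x = 0" "k v v = 0" using metric_gecD(3)[OF lm] metric_gecD(3)[OF m] v x by blast+
        have s: "l c x = k (h c) v" if c: "c \<in> S" for c
        proof -
          have "c \<in> W" using insert.prems c by blast
          then show ?thesis
            using v(2)[OF c] metric_gecD(2)[OF lm x \<open>c \<in> W\<close>]
              metric_gecD(2)[OF m v(1) partial_morphismD(2)[OF h c]] by simp
        qed
        show "l a b = k ((h(x := v)) a) ((h(x := v)) b)"
        proof (cases "a = x")
          case True
          then show ?thesis using b 0 v(2)[of b] by (cases "b = x") auto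
        next
          case False
          then have "a \<in> S" using a by blast
          then show ?thesis using False b s[of a] partial_morphismD(3)[OF h, of a b]
            by (cases "b = x") auto
        qed
      qed simp
      then show ?case by (intro exI)
    qed
    then obtain h where "partial_morphism W l V k W h" using W by blast
    then show "(W, l) \<in> skeleton V k"
      unfolding skeleton_iff[OF age_in_is_gec[OF kV]] using W age_in_is_gec[OF age] by blast
  qed
qed

text \<open>Extend the one-point extension from \<open>A\<close> to a maximal set \<open>B\<close>. It cannot reach \<open>V\<close>, since
  \<open>V\<close> is maximal. A point \<open>v\<close> outside \<open>B\<close> and the new point cannot be amalgamated over \<open>B\<close>, so they
  form a symmetric pair: \<open>v\<close> has the prescribed distances.\<close>

lemma maximal_saturated:
  assumes F: "finitary_structure F" "\<forall>(V, d)\<in>F. metric_gec V d" and cl: "layer_closed F"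
    and AP: "has_AP F" and kV: "age_in F V k"
    and max: "\<And>g. \<not> age_in F (insert None (Some ` V)) (adjoin k g)"
  shows "saturated F V k"
  unfolding saturated_def
proof (intro allI impI, elim conjE)
  fix A g assume A: "A \<subseteq> V" and g: "age_in F (insert None (Some ` A)) (adjoin k g)"
  let ?P = "\<lambda>B h. B \<subseteq> V \<and> age_in F (insert None (Some ` B)) (adjoin k h)"
  obtain B h where B: "A \<subseteq> B" "?P B h" "\<And>x. x \<in> A \<Longrightarrow> h x = g x"
    and Bmax: "\<And>C f. B \<subseteq> C \<Longrightarrow> ?P C f \<Longrightarrow> (\<And>x. x \<in> B \<Longrightarrow> f x = h x) \<Longrightarrow> C = B"
  proof (rule maximal_extension_fun[of ?P A g])
    show "?P B f" if "?P A f" "B \<subseteq> A" for A B f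
      using that age_in_subset[of F "insert None (Some ` A)" "adjoin k f" "insert None (Some ` B)"]
      by blast
    show "?P A f" if S: "\<And>S. S \<subseteq> A \<Longrightarrow> finite S \<Longrightarrow> ?P S f" for A f
    proof
      show "A \<subseteq> V" using S[of "{x}" for x] by blast
      show "age_in F (insert None (Some ` A)) (adjoin k f)"
      proof (rule age_in_finite_character)
        fix T assume T: "T \<subseteq> insert None (Some ` A)" "finite T"
        then have "age_in F (insert None (Some ` (Some -` T))) (adjoin k f)"
          using S[of "Some -` T"] by (auto simp: finite_vimageI)
        then show "age_in F T (adjoin k f)"
          by (rule age_in_subset) (use T in \<open>auto simp: image_iff\<close>)
      qed
    qed
    show "?P A f'" if f: "?P A f" "\<And>x. x \<in> A \<Longrightarrow> f' x = f x" for A f f'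
      using f by (auto intro!: age_in_cong[of F "insert None (Some ` A)" "adjoin k f"])
    show "?P A g" using A g by blast
  qed blast
  have hB: "age_in F (insert None (Some ` B)) (adjoin k h)" and BV: "B \<subseteq> V" using B(2) by blast+
  have "B \<noteq> V" using max hB by blast
  then obtain v where v: "v \<in> V" "v \<notin> B" using BV by blast
  have vB: "age_in F (insert (Some v) (Some ` B)) (adjoin k h)"
  proof -
    have pm: "partial_morphism (insert (Some v) (Some ` B)) (adjoin k h) V k (insert (Some v) (Some ` B)) the"
      by (rule partial_morphismI) (use v BV in auto)
    have "inj_on the (insert (Some v) (Some ` B))" by (auto simp: inj_on_def)
    from age_in_pullback[OF kV is_gec_pullback[OF age_in_is_gec[OF kV] pm this] pm] show ?thesis .
  qed
  have "h b = k v b" if b: "b \<in> B" for b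
  proof (rule ccontr)
    assume "h b \<noteq> k v b"
    then obtain c where
      c: "age_in F (insert None (insert (Some v) (Some ` B))) (fill_in None (Some v) (adjoin k h) c)"
      using amalgamation[where k = "adjoin k h", OF F cl AP _ _ _ _ _ hB vB, of "Some b"] b v(2) by auto
    have "age_in F (insert None (Some ` insert v B)) (adjoin k (h(v := c)))"
      unfolding image_insert by (rule age_in_cong[OF c]) (use v(2) in \<open>auto simp: fill_in_def split: if_splits\<close>)
    then have "insert v B = B" using BV v by (intro Bmax[of _ "h(v := c)"]) auto
    then show False using v(2) by blast
  qed
  then have "\<forall>a\<in>A. k v a = g a" using B(1,3) by force
  then show "\<exists>v\<in>V. \<forall>a\<in>A. k v a = g a" using v(1) by blast
qed

section \<open>The size of spaces over a layer-closed class\<close>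

text \<open>Ramsey's theorem for pairs coloured by their distance, rounded to multiples of \<open>1 / (n + 1)\<close>.\<close>

lemma nearly_equilateral_subset:
  assumes m: "metric_gec V k" and S: "S \<subseteq> V" "infinite S"
    and bd: "\<And>x y. x \<in> S \<Longrightarrow> y \<in> S \<Longrightarrow> x \<noteq> y \<Longrightarrow> \<epsilon> \<le> k x y \<and> k x y \<le> M"
  shows "\<exists>t Y. t \<in> {\<epsilon>..M} \<and> Y \<subseteq> S \<and> infinite Y \<and>
    (\<forall>x\<in>Y. \<forall>y\<in>Y. x \<noteq> y \<longrightarrow> \<bar>k x y - t\<bar> \<le> inverse (real (Suc n)))"
proof -
  \<comment> \<open>The sum over both orders of a pair counts its distance twice, and the diagonal terms vanish.\<close>
  define \<phi> where "\<phi> E = nat \<lfloor>real (Suc n) * ((\<Sum>a\<in>E. \<Sum>b\<in>E. k a b) / 2)\<rfloor>" for E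
  have \<phi>: "\<phi> {x, y} = nat \<lfloor>real (Suc n) * k x y\<rfloor>" if "x \<in> S" "y \<in> S" "x \<noteq> y" for x y
  proof -
    have xy: "x \<in> V" "y \<in> V" using that S(1) by blast+
    have "k x x = 0" "k y y = 0" "k y x = k x y"
      using metric_gecD(3)[OF m xy(1) xy(1)] metric_gecD(3)[OF m xy(2) xy(2)]
        metric_gecD(2)[OF m xy] by simp_all
    then have "(\<Sum>a\<in>{x, y}. \<Sum>b\<in>{x, y}. k a b) / 2 = k x y" using that(3) by simp
    then show ?thesis unfolding \<phi>_def by (rule arg_cong)
  qed
  have "\<forall>x\<in>S. \<forall>y\<in>S. x \<noteq> y \<longrightarrow> \<phi> {x, y} < Suc (nat \<lfloor>real (Suc n) * M\<rfloor>)"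
  proof (intro ballI impI)
    fix x y assume xy: "x \<in> S" "y \<in> S" "x \<noteq> y"
    have "real (Suc n) * k x y \<le> real (Suc n) * M"
      using bd[OF xy] by (intro mult_left_mono) auto
    then have "nat \<lfloor>real (Suc n) * k x y\<rfloor> \<le> nat \<lfloor>real (Suc n) * M\<rfloor>"
      by (intro nat_mono floor_mono)
    then show "\<phi> {x, y} < Suc (nat \<lfloor>real (Suc n) * M\<rfloor>)" unfolding \<phi>[OF xy] by simp
  qed
  from Ramsey2[OF S(2) this] obtain Y j where Y: "Y \<subseteq> S" "infinite Y"
    and j0: "\<forall>x\<in>Y. \<forall>y\<in>Y. x \<noteq> y \<longrightarrow> \<phi> {x, y} = j" by (elim exE conjE)
  have j: "\<phi> {x, y} = j" if "x \<in> Y" "y \<in> Y" "x \<noteq> y" for x y using j0 that by simp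
  obtain p where p: "p \<in> Y" using Y(2) infinite_imp_nonempty by blast
  have "Y - {p} \<noteq> {}" using Y(2) by (metis finite.emptyI finite_Diff_insert Diff_empty)
  then obtain q where q: "q \<in> Y" "p \<noteq> q" by blast
  have "\<bar>k x y - k p q\<bar> \<le> inverse (real (Suc n))" if xy: "x \<in> Y" "y \<in> Y" "x \<noteq> y" for x y
  proof -
    have S': "x \<in> S" "y \<in> S" "p \<in> S" "q \<in> S" using xy p q Y(1) by blast+
    have nn: "0 \<le> real (Suc n) * k x y" "0 \<le> real (Suc n) * k p q"
      using metric_gecD(1)[OF m] S' S(1) by (meson mult_nonneg_nonneg of_nat_0_le_iff subsetD)+
    have "nat \<lfloor>real (Suc n) * k x y\<rfloor> = nat \<lfloor>real (Suc n) * k p q\<rfloor>"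
      using j[OF xy] j[OF p q] \<phi>[OF S'(1,2) xy(3)] \<phi>[OF S'(3,4) q(2)] by simp
    then have "\<lfloor>real (Suc n) * k x y\<rfloor> = \<lfloor>real (Suc n) * k p q\<rfloor>"
      using nn by (simp add: eq_nat_nat_iff del: of_nat_Suc)
    then have "\<bar>real (Suc n) * k x y - real (Suc n) * k p q\<bar> \<le> 1" by linarith
    then have "real (Suc n) * \<bar>k x y - k p q\<bar> \<le> 1"
      by (simp add: abs_mult right_diff_distrib[symmetric] del: of_nat_Suc)
    then show ?thesis by (simp add: field_simps del: of_nat_Suc)
  qed
  moreover have "k p q \<in> {\<epsilon>..M}" using bd[of p q] p q Y(1) by auto
  ultimately show ?thesis using Y by blast
qed

text \<open>The side lengths of nearly equilateral subspaces accumulate at some positive \<open>\<tau>\<close>. By closedness of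
  the layers \<open>F\<close> contains equilateral spaces of side \<open>\<tau>\<close> and any finite size, which MBP forbids.\<close>

lemma no_infinite_separated_subset:
  assumes F: "finitary_structure F" "\<forall>(V, d)\<in>F. metric_gec V d" and cl: "layer_closed F"
    and mbp: "mbp F" and kV: "age_in F V k" and S: "S \<subseteq> V" and \<epsilon>: "0 < \<epsilon>"
    and bd: "\<And>x y. x \<in> S \<Longrightarrow> y \<in> S \<Longrightarrow> x \<noteq> y \<Longrightarrow> \<epsilon> \<le> k x y \<and> k x y \<le> M"
  shows "finite S"
proof (rule ccontr)
  assume inf: "infinite S"
  note m = age_in_metric_class[OF F(2) kV]
  have "\<forall>n. \<exists>t Y. t \<in> {\<epsilon>..M} \<and> Y \<subseteq> S \<and> infinite Y \<and>
    (\<forall>x\<in>Y. \<forall>y\<in>Y. x \<noteq> y \<longrightarrow> \<bar>k x y - t\<bar> \<le> inverse (real (Suc n)))"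
    by (intro allI nearly_equilateral_subset[OF m S inf]) (rule bd)
  then obtain t Y where t: "\<And>n. t n \<in> {\<epsilon>..M}" and Y: "\<And>n. Y n \<subseteq> S" "\<And>n. infinite (Y n)"
    and close: "\<And>n x y. x \<in> Y n \<Longrightarrow> y \<in> Y n \<Longrightarrow> x \<noteq> y \<Longrightarrow> \<bar>k x y - t n\<bar> \<le> inverse (real (Suc n))"
    by metis
  obtain \<tau> r where \<tau>: "\<tau> \<in> {\<epsilon>..M}" and r: "strict_mono r" and lim: "(t \<circ> r) \<longlonglongrightarrow> \<tau>"
    using compact_Icc[of \<epsilon> M] t unfolding compact_def by blast
  have "\<exists>N. \<forall>(V, k)\<in>F. (\<forall>x\<in>V. \<forall>y\<in>V. x \<noteq> y \<longrightarrow> k x y = \<tau>) \<longrightarrow> card V \<le> N"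
    using mbp unfolding mbp_def by (rule spec)
  then obtain N where
    N0: "\<forall>(V, k)\<in>F. (\<forall>x\<in>V. \<forall>y\<in>V. x \<noteq> y \<longrightarrow> k x y = \<tau>) \<longrightarrow> card V \<le> N" ..
  have N: "card V \<le> N" if "(V, k) \<in> F" "\<forall>x\<in>V. \<forall>y\<in>V. x \<noteq> y \<longrightarrow> k x y = \<tau>" for V k
    using bspec[OF N0 that(1)] that(2) by simp
  let ?W = "{..N}"
  let ?K = "\<lambda>i j :: nat. if i = j then 0 else \<tau>"
  have "\<exists>e. inj_on e ?W \<and> e ` ?W \<subseteq> Y (r n)" for n
  proof -
    obtain B where B: "finite B" "card B = card ?W" "B \<subseteq> Y (r n)"
      using infinite_arbitrarily_large[OF Y(2)] by blast
    obtain e where "bij_betw e ?W B" using finite_same_card_bij[of ?W B] B by auto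
    then show ?thesis using B(3) unfolding bij_betw_def by blast
  qed
  then obtain e where e: "\<And>n. inj_on (e n) ?W" "\<And>n. e n ` ?W \<subseteq> Y (r n)" by metis
  have eY: "e n i \<in> Y (r n)" if "i \<in> ?W" for n i using e(2) that by blast
  have "age_in F ?W ?K"
  proof (rule age_in_limit[OF F cl])
    fix n
    have pm: "partial_morphism ?W (\<lambda>i j. k (e n i) (e n j)) V k ?W (e n)"
      by (rule partial_morphismI) (use eY Y(1) S in blast)+
    show "age_in F ?W (\<lambda>i j. k (e n i) (e n j))"
      by (rule age_in_pullback[OF kV is_gec_pullback[OF age_in_is_gec[OF kV] pm e(1)] pm])
  next
    fix i j assume ij: "i \<in> ?W" "j \<in> ?W"
    show "(\<lambda>n. k (e n i) (e n j)) \<longlonglongrightarrow> ?K i j"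
    proof (cases "i = j")
      case True
      have "e n i \<in> V" for n using eY[OF ij(1)] Y(1) S by blast
      then have "k (e n i) (e n j) = 0" for n using metric_gecD(3)[OF m] True by blast
      then show ?thesis using True by simp
    next
      case False
      have "\<bar>k (e n i) (e n j) - (t \<circ> r) n\<bar> \<le> inverse (real (Suc n))" for n
      proof -
        have "e n i \<noteq> e n j" using inj_onD[OF e(1) _ ij] False by blast
        from close[OF eY[OF ij(1)] eY[OF ij(2)] this]
        have "\<bar>k (e n i) (e n j) - t (r n)\<bar> \<le> inverse (real (Suc (r n)))" .
        also have "\<dots> \<le> inverse (real (Suc n))"
          using seq_suble[OF r, of n] by (intro le_imp_inverse_le) auto
        finally show ?thesis by simp
      qed
      then have "(\<lambda>n. k (e n i) (e n j) - (t \<circ> r) n) \<longlonglongrightarrow> 0"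
        by (intro Lim_null_comparison[OF _ LIMSEQ_inverse_real_of_nat]) simp
      from tendsto_add[OF this lim] show ?thesis using False by simp
    qed
    assume "i \<noteq> j"
    then show "?K i j \<noteq> 0" using \<tau> \<epsilon> by simp
  qed simp
  then have "(?W, ?K) \<in> F" using finitary_mem_iff_age_in[OF F(1), of ?W] by blast
  then have "card ?W \<le> N" by (rule N) simp
  then show False by simp
qed

text \<open>Maximal \<open>\<epsilon>\<close>-separated sets are \<open>\<epsilon>\<close>-nets, and they are countable because their bounded parts are
  finite. A point is determined by the net points near it, at all scales \<open>1 / (n + 1)\<close>.\<close>

lemma metric_lepoll_continuum:
  assumes m: "metric_gec V k"
    and fin: "\<And>S \<epsilon> M. S \<subseteq> V \<Longrightarrow> 0 < \<epsilon> \<Longrightarrow>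
      (\<And>x y. x \<in> S \<Longrightarrow> y \<in> S \<Longrightarrow> x \<noteq> y \<Longrightarrow> \<epsilon> \<le> k x y \<and> k x y \<le> M) \<Longrightarrow> finite S"
  shows "V \<lesssim> (UNIV :: real set)"
proof (cases "V = {}")
  case True
  then show ?thesis by simp
next
  case False
  then obtain p where o: "p \<in> V" by blast
  have "\<exists>A. A \<subseteq> V \<and> countable A \<and> (\<forall>v\<in>V. \<exists>a\<in>A. k v a < \<epsilon>)" if \<epsilon>: "0 < \<epsilon>" for \<epsilon>
  proof -
    let ?P = "\<lambda>A (f :: _ \<Rightarrow> unit). A \<subseteq> V \<and> (\<forall>x\<in>A. \<forall>y\<in>A. x \<noteq> y \<longrightarrow> \<epsilon> \<le> k x y)"
    obtain A and f :: "_ \<Rightarrow> unit" where A: "?P A f"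
      and max: "\<And>C f'. A \<subseteq> C \<Longrightarrow> ?P C f' \<Longrightarrow> (\<And>x. x \<in> A \<Longrightarrow> f' x = f x) \<Longrightarrow> C = A"
    proof (rule maximal_extension_fun[of ?P "{}" "\<lambda>_. ()"])
      show "?P A f" if S: "\<And>S. S \<subseteq> A \<Longrightarrow> finite S \<Longrightarrow> ?P S f" for A f
      proof (intro conjI subsetI ballI impI)
        show "x \<in> V" if "x \<in> A" for x using S[of "{x}"] that by simp
        show "\<epsilon> \<le> k x y" if "x \<in> A" "y \<in> A" "x \<noteq> y" for x y
          using S[of "{x, y}"] that by simp
      qed
      show "?P B f" if P: "?P A f" and B: "B \<subseteq> A" for A B f
        using subset_trans[OF B conjunct1[OF P]] conjunct2[OF P] subsetD[OF B] by simp
    qed (assumption | simp)+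
    have near: "\<exists>a\<in>A. k v a < \<epsilon>" if v: "v \<in> V" for v
    proof (rule ccontr)
      assume "\<not> (\<exists>a\<in>A. k v a < \<epsilon>)"
      then have far: "\<epsilon> \<le> k v a \<and> \<epsilon> \<le> k a v" if "a \<in> A" for a
        using that A metric_gecD(2)[OF m v, of a] by force
      then have "?P (insert v A) f" using A v by simp
      then have "v \<in> A" using max[of "insert v A" f] by blast
      then have "\<epsilon> \<le> k v v" using far by blast
      then show False using metric_gecD(3)[OF m v v] \<epsilon> by simp
    qed
    have "countable A"
    proof -
      have "finite {a \<in> A. k p a \<le> real M}" for M
      proof (rule fin[OF _ \<epsilon>, of _ "2 * real M"])
        fix x y assume x: "x \<in> {a \<in> A. k p a \<le> real M}" and y: "y \<in> {a \<in> A. k p a \<le> real M}"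
          and ne: "x \<noteq> y"
        have V: "x \<in> V" "y \<in> V" using x y A by blast+
        have "k x y \<le> k x p + k p y" by (rule metric_gecD(4)[OF m V(1) o V(2)])
        also have "k x p = k p x" by (rule metric_gecD(2)[OF m o V(1)])
        finally have "k x y \<le> 2 * real M" using x y by simp
        then show "\<epsilon> \<le> k x y \<and> k x y \<le> 2 * real M" using A x y ne by blast
      qed (use A in blast)
      then have "countable (\<Union>M. {a \<in> A. k p a \<le> real M})"
        by (intro countable_UN[OF countableI_type] countable_finite)
      moreover have "A \<subseteq> (\<Union>M. {a \<in> A. k p a \<le> real M})" using real_arch_simple by blast
      ultimately show ?thesis by (rule countable_subset[rotated])
    qed
    then show ?thesis using conjunct1[OF A] near by (intro exI[of _ A] conjI ballI)
  qed
  note net0 = this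
  have "\<forall>n. \<exists>A. A \<subseteq> V \<and> countable A \<and> (\<forall>v\<in>V. \<exists>a\<in>A. k v a < inverse (real (Suc n)))"
    by (intro allI net0) simp
  then obtain A where
    A0: "\<forall>n. A n \<subseteq> V \<and> countable (A n) \<and> (\<forall>v\<in>V. \<exists>a\<in>A n. k v a < inverse (real (Suc n)))"
    by (rule choice[THEN exE])
  then have A: "A n \<subseteq> V" "countable (A n)"
    and net: "v \<in> V \<Longrightarrow> \<exists>a\<in>A n. k v a < inverse (real (Suc n))" for n v by simp_all
  define \<psi> where "\<psi> v = {prod_encode (n, to_nat_on (A n) a) |n a. a \<in> A n \<and> k v a < inverse (real (Suc n))}" for v
  have "inj_on \<psi> V"
  proof (rule inj_onI, rule ccontr)
    fix v w assume vw: "v \<in> V" "w \<in> V" "\<psi> v = \<psi> w" "v \<noteq> w"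
    have "0 < k v w" using metric_gecD(1,3)[OF m vw(1,2)] vw(4) by linarith
    then obtain n where n: "inverse (real (Suc n)) < k v w / 2"
      using reals_Archimedean[of "k v w / 2"] by auto
    obtain a where a: "a \<in> A n" "k v a < inverse (real (Suc n))" using net[OF vw(1)] by blast
    then have "prod_encode (n, to_nat_on (A n) a) \<in> \<psi> v" unfolding \<psi>_def by blast
    then have "prod_encode (n, to_nat_on (A n) a) \<in> \<psi> w" unfolding vw(3) .
    then obtain b where b: "b \<in> A n" "to_nat_on (A n) b = to_nat_on (A n) a" "k w b < inverse (real (Suc n))"
      unfolding \<psi>_def by auto
    have "b = a" using b(1,2) a(1) A(2) by (simp add: inj_on_to_nat_on inj_onD)
    have aV: "a \<in> V" using a(1) A(1) by blast
    have "k v w \<le> k v a + k a w" by (rule metric_gecD(4)[OF m vw(1) aV vw(2)])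
    also have "k a w = k w a" by (rule metric_gecD(2)[OF m vw(2) aV])
    finally show False using a(2) b(3) n unfolding \<open>b = a\<close> by linarith
  qed
  then have "V \<lesssim> (UNIV :: nat set set)" unfolding lepoll_def by blast
  also have "(UNIV :: nat set set) \<lesssim> (UNIV :: real set)" by (rule eqpoll_imp_lepoll[OF nat_sets_eqpoll_reals])
  finally show ?thesis .
qed

text \<open>The type that has to carry the generating space is a power set of \<^typ>\<open>real + nat\<close>, so by Cantor's
  theorem a set of at most continuum many points leaves room in it for another point.\<close>

lemma not_UNIV_lepoll_continuum: "\<not> (UNIV :: (real + nat) set set) \<lesssim> (UNIV :: real set)"
proof
  assume "(UNIV :: (real + nat) set set) \<lesssim> (UNIV :: real set)"
  also have "(UNIV :: real set) \<lesssim> (UNIV :: (real + nat) set)"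
    unfolding lepoll_def using inj_Inl by blast
  finally have "Pow (UNIV :: (real + nat) set) \<lesssim> (UNIV :: (real + nat) set)" by simp
  then show False using lesspoll_Pow_self[of "UNIV :: (real + nat) set"]
    unfolding lesspoll_def using lepoll_antisym by blast
qed

text \<open>A maximal \<open>F\<close>-space inside the given type does not exhaust the type, so a proper one-point extension
  could be realised there by an unused element. Hence it has no such extension at all, and it is saturated.\<close>

theorem layer_closed_skeletoid_is_skeleton:
  assumes sk: "metric_skeletoid F" and cl: "layer_closed F"
  shows "is_skeleton F"
proof -
  have F: "finitary_structure F" "\<forall>(V, d)\<in>F. metric_gec V d" and AP: "has_AP F" and mbp: "mbp F"
    using sk unfolding metric_skeletoid_def skeletoid_def proper_structure_def by blast+
  obtain V :: "(real + nat) set set" and k where kV: "age_in F V k"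
    and max: "\<And>C l. V \<subseteq> C \<Longrightarrow> age_in F C l \<Longrightarrow>
      (\<And>x y. x \<in> V \<Longrightarrow> y \<in> V \<Longrightarrow> l x y = k x y) \<Longrightarrow> C = V"
  proof (rule maximal_extension[of "age_in F" "{}" "\<lambda>_ _. 0"])
    show "age_in F B k" if "age_in F A k" "B \<subseteq> A" for A B k using that by (rule age_in_subset)
    show "age_in F A k" if "\<And>S. S \<subseteq> A \<Longrightarrow> finite S \<Longrightarrow> age_in F S k" for A k
      using that by (rule age_in_finite_character)
    show "age_in F A l" if "age_in F A k" "\<And>x y. x \<in> A \<Longrightarrow> y \<in> A \<Longrightarrow> l x y = k x y" for A k l
      using that by (rule age_in_cong)
    show "age_in F {} (\<lambda>_ _. 0)"
      unfolding age_in_def is_gec_def skeleton_def by auto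
  qed blast
  note m = age_in_metric_class[OF F(2) kV]
  have "V \<lesssim> (UNIV :: real set)"
    by (rule metric_lepoll_continuum[OF m no_infinite_separated_subset[OF F cl mbp kV]])
  then have "V \<noteq> UNIV" using not_UNIV_lepoll_continuum by metis
  then obtain p where p: "p \<notin> V" by blast
  have "\<not> age_in F (insert None (Some ` V)) (adjoin k g)" for g
  proof
    let ?U = "insert None (Some ` V)"
    let ?h = "\<lambda>x. if x = p then None else Some x"
    let ?l = "\<lambda>x y. adjoin k g (?h x) (?h y)"
    assume age: "age_in F ?U (adjoin k g)"
    have pm: "partial_morphism (insert p V) ?l ?U (adjoin k g) (insert p V) ?h"
      by (rule partial_morphismI) auto
    have "inj_on ?h (insert p V)" by (auto simp: inj_on_def)
    then have "age_in F (insert p V) ?l"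
      using age_in_pullback[OF age is_gec_pullback[OF age_in_is_gec[OF age] pm] pm] by blast
    then have "insert p V = V" by (rule max[rotated]) (use p in auto)
    then show False using p by blast
  qed
  then have sat: "saturated F V k" by (rule maximal_saturated[OF F cl AP kV])
  show ?thesis unfolding is_skeleton_def
    using saturated_ab_ho[OF F(2) sat kV] saturated_skeleton[OF F sat kV] by blast
qed

theorem layer_closed_skeletoid_edge_closed:
  assumes sk: "metric_skeletoid F" and cl: "layer_closed F"
  shows "edge_closed F"
  unfolding edge_closed_def
proof (intro allI impI, elim conjE)
  have F: "finitary_structure F" "\<forall>(V, d)\<in>F. metric_gec V d"
    using sk unfolding metric_skeletoid_def skeletoid_def proper_structure_def by blast+
  fix V a b k
  assume inc: "incomplete_gec V a b k" and ns: "non_symmetric V a b k" and aff: "affiliated F V a b k"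
  have ab: "a \<in> V" "b \<in> V" "a \<noteq> b" using inc unfolding incomplete_gec_def by blast+
  obtain v where v: "v \<in> V - {a, b}" "k a v \<noteq> k b v" using ns unfolding non_symmetric_def by blast
  have "finite (V - {a})" using aff finitary_structureD(4)[OF F(1)] unfolding affiliated_def by blast
  then have V: "finite V" by simp
  have "Delta F V a b k = {c. age_in F V (fill_in a b k c)}"
    unfolding Delta_def using finitary_mem_iff_age_in[OF F(1) V] ab(1) by blast
  then show "closed (Delta F V a b k)" using closed_completion_colors[where k = k, OF F cl V ab v] by simp
qed

section \<open>Moving configurations in an absolutely homogeneous space\<close>

locale ab_ho_metric_space = Metric_space M d for M :: "'a set" and d +
  assumes ab_ho: "ab_ho M d"
begin

lemma metric_gec: "metric_gec M d"
  by (rule Metric_space_metric_gec[OF Metric_space_axioms])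

lemma is_gec: "is_gec M d"
  by (rule metric_gec_is_gec[OF metric_gec])

lemma age_skeleton: "age_in (skeleton M d) M d"
  unfolding age_in_def using is_gec by blast

definition automorphism :: "('a \<Rightarrow> 'a) \<Rightarrow> bool" where
  "automorphism g \<longleftrightarrow> gec_iso M d M d g"

lemma automorphismD:
  assumes "automorphism g"
  shows "g ` M = M" "inj_on g M" "x \<in> M \<Longrightarrow> g x \<in> M"
    "x \<in> M \<Longrightarrow> y \<in> M \<Longrightarrow> d (g x) (g y) = d x y"
proof -
  have pm: "partial_morphism M d M d M g" and bij: "bij_betw g M M"
    using assms unfolding automorphism_def gec_iso_def by blast+
  show "g ` M = M" "inj_on g M" using bij unfolding bij_betw_def by blast+
  show "x \<in> M \<Longrightarrow> g x \<in> M" using partial_morphismD(2)[OF pm] .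
  show "x \<in> M \<Longrightarrow> y \<in> M \<Longrightarrow> d (g x) (g y) = d x y" using partial_morphismD(3)[OF pm] by metis
qed

lemma automorphism_inv: "automorphism g \<Longrightarrow> automorphism (inv_into M g)"
  unfolding automorphism_def by (rule gec_iso_inv)

lemma extend_to_automorphism:
  assumes "partial_morphism M d M d A f"
  obtains g where "automorphism g" "\<And>a. a \<in> A \<Longrightarrow> g a = f a"
proof -
  have "\<forall>A f. partial_morphism M d M d A f \<longrightarrow> (\<exists>g. gec_iso M d M d g \<and> (\<forall>a\<in>A. g a = f a))"
    using ab_ho unfolding ab_ho_def by (rule conjunct2)
  with assms obtain g where "gec_iso M d M d g" "\<forall>a\<in>A. g a = f a" by metis
  then show thesis by (intro that[of g]) (simp_all add: automorphism_def)
qed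

lemma move_pair:
  assumes M: "x \<in> M" "y \<in> M" "x' \<in> M" "y' \<in> M" and eq: "d x y = d x' y'"
  obtains g where "automorphism g" "g x = x'" "g y = y'"
proof -
  let ?f = "\<lambda>z. if z = x then x' else y'"
  have xy: "x = y \<longleftrightarrow> x' = y'" using M eq zero by metis
  have pm: "partial_morphism M d M d {x, y} ?f"
  proof (rule partial_morphismI)
    show "{x, y} \<subseteq> M" using M by simp
    show "?f a \<in> M" if "a \<in> {x, y}" for a using M by simp
    show "d a b = d (?f a) (?f b)" if "a \<in> {x, y}" "b \<in> {x, y}" for a b
      using that M eq xy mdist_zero commute by auto
  qed
  obtain g where g: "automorphism g" "\<And>a. a \<in> {x, y} \<Longrightarrow> g a = ?f a"
    using extend_to_automorphism[OF pm] by metis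
  have "g x = x'" "g y = y'" using g(2)[of x] g(2)[of y] xy by (auto split: if_splits)
  with g(1) show thesis by (rule that)
qed

lemma move_point:
  assumes "x \<in> M" "y \<in> M"
  obtains g where "automorphism g" "g x = y"
  using move_pair[of x x y y] assms by auto

end

section \<open>Compact balls, closed layers and completeness\<close>

lemma (in Metric_space) finite_common_subsequence:
  assumes K: "compactin mtopology K" and J: "finite J" and h: "\<And>i j. j \<in> J \<Longrightarrow> h i j \<in> K"
  shows "\<exists>s l. strict_mono (s :: nat \<Rightarrow> nat) \<and>
    (\<forall>j\<in>J. limitin mtopology (\<lambda>i. h (s i) j) (l j) sequentially)"
  using J h
proof (induction J)
  case empty
  show ?case by (intro exI[of _ id]) (simp add: strict_mono_def)
next
  case (insert j J)
  then obtain s l where s: "strict_mono (s :: nat \<Rightarrow> nat)"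
    and l: "\<And>j. j \<in> J \<Longrightarrow> limitin mtopology (\<lambda>i. h (s i) j) (l j) sequentially"
    by (meson insertI2)
  have "range (\<lambda>i. h (s i) j) \<subseteq> K" using insert.prems by blast
  then obtain y r where r: "strict_mono (r :: nat \<Rightarrow> nat)"
    and y: "limitin mtopology ((\<lambda>i. h (s i) j) \<circ> r) y sequentially"
    using K unfolding compactin_sequentially by blast
  have "limitin mtopology (\<lambda>i. h ((s \<circ> r) i) m) ((l(j := y)) m) sequentially"
    if "m \<in> insert j J" for m
  proof (cases "m = j")
    case True
    then show ?thesis using y by (simp add: o_def)
  next
    case False
    then have "m \<in> J" using that by blast
    from limitin_subsequence[OF r l[OF this]] show ?thesis using False by (simp add: o_def)
  qed
  moreover have "strict_mono (s \<circ> r)" using s r by (rule strict_mono_o)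
  ultimately show ?case by (intro exI[of _ "s \<circ> r"] exI[of _ "l(j := y)"]) blast
qed

lemma (in Metric_space) limitin_mdist:
  assumes x: "limitin mtopology x l sequentially" and y: "limitin mtopology y m sequentially"
    and M: "\<And>i. x i \<in> M" "\<And>i. y i \<in> M"
  shows "(\<lambda>i. d (x i) (y i)) \<longlonglongrightarrow> d l m"
proof -
  have lm: "l \<in> M" "m \<in> M" and 0: "(\<lambda>i. d (x i) l) \<longlonglongrightarrow> 0" "(\<lambda>i. d (y i) m) \<longlonglongrightarrow> 0"
    using x y unfolding limitin_metric_dist_null by blast+
  have "\<bar>d (x i) (y i) - d l m\<bar> \<le> d (x i) l + d (y i) m" for i
    using triangle[OF M(1) lm(1) M(2), of i i] triangle[OF lm(1) lm(2) M(2), of i]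
      triangle[OF lm(1) M(1) lm(2), of i] triangle[OF M(1) M(2) lm(2), of i i]
      commute[of l "x i"] commute[of m "y i"] by linarith
  then have "(\<lambda>i. d (x i) (y i) - d l m) \<longlonglongrightarrow> 0"
    by (intro Lim_null_comparison[OF _ tendsto_add_zero[OF 0]]) simp
  then show ?thesis by (rule LIM_zero_cancel)
qed

context ab_ho_metric_space
begin

text \<open>Realise the converging metrics by points of the space and move the first of these points to a common
  place \<open>p\<close>. Then all points lie in the compact ball around \<open>p\<close>, and the limit of a subsequence realises the
  limit metric.\<close>

lemma compact_balls_bounded_layers_closed:
  assumes compact: "\<And>x. x \<in> M \<Longrightarrow> compactin mtopology (mcball x r)"
  shows "bounded_layers_closed (skeleton M d) r"
  unfolding bounded_layers_closed_def closedin_metrics_sequential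
proof (intro allI impI conjI)
  fix n :: nat assume n: "0 < n"
  show "bounded_metrics_in (skeleton M d) r n \<subseteq> metrics_on n"
    using bounded_metrics_in_mem by blast
  fix \<delta> D assume \<delta>0: "\<forall>i. \<delta> i \<in> bounded_metrics_in (skeleton M d) r n" and D: "D \<in> metrics_on n"
    and lim0: "\<forall>x y. (\<lambda>i. \<delta> i x y) \<longlonglongrightarrow> D x y"
  let ?I = "{1..n}"
  have bd: "\<delta> i j k \<le> r" if "j \<in> ?I" "k \<in> ?I" for i j k
    using spec[OF \<delta>0, of i] that unfolding bounded_metrics_in_mem by simp
  have one: "1 \<in> ?I" using n by simp
  have "\<exists>f. partial_morphism ?I (\<delta> i) M d ?I f" for i
    using spec[OF \<delta>0, of i] unfolding bounded_metrics_in_mem skeleton_iff[OF is_gec] by blast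
  then obtain f where f: "\<And>i. partial_morphism ?I (\<delta> i) M d ?I (f i)" by metis
  define p where "p = f 0 1"
  have p: "p \<in> M" unfolding p_def by (rule partial_morphismD(2)[OF f one])
  have "\<exists>g. automorphism g \<and> g (f i 1) = p" for i
    using move_point[OF partial_morphismD(2)[OF f one] p] by metis
  then obtain g where g: "\<And>i. automorphism (g i)" "\<And>i. g i (f i 1) = p" by metis
  define h where "h i j = g i (f i j)" for i j
  have hM: "h i j \<in> M" if "j \<in> ?I" for i j
    unfolding h_def by (rule automorphismD(3)[OF g(1) partial_morphismD(2)[OF f that]])
  have hd: "d (h i j) (h i k) = \<delta> i j k" if "j \<in> ?I" "k \<in> ?I" for i j k
    unfolding h_def partial_morphismD(3)[OF f that]
    by (rule automorphismD(4)[OF g(1) partial_morphismD(2)[OF f that(1)] partial_morphismD(2)[OF f that(2)]])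
  have "h i j \<in> mcball p r" if "j \<in> ?I" for i j
    using hd[OF one that, of i] bd[OF one that, of i] hM[OF that, of i] p g(2)[of i]
    by (simp add: h_def)
  from finite_common_subsequence[where h = h, OF compact[OF p] finite_atLeastAtMost this]
  obtain s l where s: "strict_mono (s :: nat \<Rightarrow> nat)"
    and l: "\<And>j. j \<in> ?I \<Longrightarrow> limitin mtopology (\<lambda>i. h (s i) j) (l j) sequentially" by blast
  have lM: "l j \<in> M" if "j \<in> ?I" for j using l[OF that] unfolding limitin_metric_dist_null by blast
  have Dl: "D j k = d (l j) (l k)" if jk: "j \<in> ?I" "k \<in> ?I" for j k
  proof (rule LIMSEQ_unique)
    show "(\<lambda>i. d (h (s i) j) (h (s i) k)) \<longlonglongrightarrow> d (l j) (l k)"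
      by (rule limitin_mdist[OF l[OF jk(1)] l[OF jk(2)] hM[OF jk(1)] hM[OF jk(2)]])
    have "(\<lambda>i. \<delta> i j k) \<longlonglongrightarrow> D j k" using lim0 by blast
    from LIMSEQ_subseq_LIMSEQ[OF this s]
    show "(\<lambda>i. d (h (s i) j) (h (s i) k)) \<longlonglongrightarrow> D j k" unfolding hd[OF jk] by (simp add: o_def)
  qed
  have "partial_morphism ?I D M d ?I l" by (rule partial_morphismI) (use lM Dl in simp_all)
  moreover have "is_gec ?I D" using D metric_gec_is_gec unfolding metrics_on_iff by blast
  ultimately have "(?I, D) \<in> skeleton M d" unfolding skeleton_iff[OF is_gec] using one by blast
  moreover have "D j k \<le> r" if jk: "j \<in> ?I" "k \<in> ?I" for j k
  proof (rule LIMSEQ_le_const2)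
    show "(\<lambda>i. \<delta> i j k) \<longlonglongrightarrow> D j k" using lim0 by blast
    show "\<exists>N. \<forall>i\<ge>N. \<delta> i j k \<le> r" using bd[OF jk] by blast
  qed
  ultimately show "D \<in> bounded_metrics_in (skeleton M d) r n"
    unfolding bounded_metrics_in_mem using D by blast
qed

lemma extend_finite_embedding:
  assumes age: "age_in (skeleton M d) (insert y A) l" and A: "finite A"
    and h: "partial_morphism A l M d A h"
  shows "\<exists>h'. partial_morphism (insert y A) l M d (insert y A) h' \<and> (\<forall>a\<in>A. h' a = h a)"
proof -
  obtain e where e: "partial_morphism (insert y A) l M d (insert y A) e"
    using finite_age_in_skeleton_embeds[OF is_gec _ age] A by auto
  have inj: "inj_on e A"
    using partial_morphism_inj_on[OF age_in_is_gec[OF age] is_gec e] by (rule inj_on_subset) blast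
  have "partial_morphism M d M d (e ` A) (\<lambda>w. h (inv_into A e w))"
  proof (rule partial_morphismI)
    show "e ` A \<subseteq> M" using partial_morphismD(2)[OF e] by blast
    show "h (inv_into A e w) \<in> M" if "w \<in> e ` A" for w
      by (rule partial_morphismD(2)[OF h]) (rule inv_into_into[OF that])
    fix v w assume "v \<in> e ` A" "w \<in> e ` A"
    then obtain a b where ab: "a \<in> A" "b \<in> A" "v = e a" "w = e b" by blast
    have "d v w = l a b" unfolding ab(3,4) using partial_morphismD(3)[OF e, of a b] ab by simp
    also have "\<dots> = d (h a) (h b)" by (rule partial_morphismD(3)[OF h ab(1,2)])
    finally show "d v w = d (h (inv_into A e v)) (h (inv_into A e w))" using ab inj by simp
  qed
  from extend_to_automorphism[OF this] obtain g where g: "automorphism g"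
    and ge: "\<And>w. w \<in> e ` A \<Longrightarrow> g w = h (inv_into A e w)" by blast
  show ?thesis
  proof (intro exI[of _ "\<lambda>a. g (e a)"] conjI ballI)
    show "partial_morphism (insert y A) l M d (insert y A) (\<lambda>a. g (e a))"
    proof (rule partial_morphismI[OF subset_refl])
      fix a assume a: "a \<in> insert y A"
      show "g (e a) \<in> M" by (rule automorphismD(3)[OF g partial_morphismD(2)[OF e a]])
      fix b assume b: "b \<in> insert y A"
      show "l a b = d (g (e a)) (g (e b))"
        unfolding automorphismD(4)[OF g partial_morphismD(2)[OF e a] partial_morphismD(2)[OF e b]]
        by (rule partial_morphismD(3)[OF e a b])
    qed
    show "g (e a) = h a" if "a \<in> A" for a using ge[of "e a"] that inj by simp
  qed
qed

text \<open>Points are embedded one after the other. A finite subspace enlarged by one point embeds somewhere in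
  the space, and finite homogeneity moves this copy onto the one already chosen.\<close>

lemma countable_age_in_skeleton_embeds:
  assumes Y: "countable Y" and age: "age_in (skeleton M d) Y l"
  shows "\<exists>h. partial_morphism Y l M d Y h"
proof (cases "Y = {}")
  case True
  then show ?thesis by (simp add: partial_morphism_def)
next
  case False
  define q where "q = from_nat_into Y"
  have rq: "range q = Y" unfolding q_def by (rule range_from_nat_into[OF False Y])
  have Qsub: "q ` {..<n} \<subseteq> Y" for n using rq by blast
  have step: "\<exists>h'. partial_morphism (q ` {..<Suc n}) l M d (q ` {..<Suc n}) h' \<and> (\<forall>a\<in>q ` {..<n}. h' a = h a)"
    if h: "partial_morphism (q ` {..<n}) l M d (q ` {..<n}) h" for h n
  proof -
    have eq: "q ` {..<Suc n} = insert (q n) (q ` {..<n})" by (simp add: lessThan_Suc)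
    have "age_in (skeleton M d) (insert (q n) (q ` {..<n})) l"
      using age_in_subset[OF age Qsub[of "Suc n"]] unfolding eq .
    from extend_finite_embedding[OF this _ h] show ?thesis unfolding eq by simp
  qed
  have "\<exists>H. \<forall>n. partial_morphism (q ` {..<n}) l M d (q ` {..<n}) (H n) \<and>
      (\<forall>a\<in>q ` {..<n}. H (Suc n) a = H n a)"
    by (rule dependent_nat_choice) (simp add: partial_morphism_def, rule step)
  then obtain H where H: "\<And>n. partial_morphism (q ` {..<n}) l M d (q ` {..<n}) (H n)"
    and Suc: "\<And>n a. a \<in> q ` {..<n} \<Longrightarrow> H (Suc n) a = H n a" by blast
  have agree: "H m a = H n a" if "n \<le> m" "a \<in> q ` {..<n}" for n m a
    using that(1)
  proof (induction m rule: dec_induct)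
    case (step m)
    have "a \<in> q ` {..<m}" using that(2) step.hyps by auto
    from Suc[OF this] step.IH show ?case by simp
  qed simp
  define i where "i y = (SOME n. q n = y)" for y
  have i: "q (i y) = y" if "y \<in> Y" for y
    using someI_ex[of "\<lambda>n. q n = y"] that rq unfolding i_def by blast
  define h where "h y = H (Suc (i y)) y" for y
  have h: "h y = H m y" if "y \<in> Y" "i y < m" for y m
    unfolding h_def using agree[of "Suc (i y)" m y] that i by (metis Suc_leI imageI lessI lessThan_iff)
  have "partial_morphism Y l M d Y h"
  proof (rule partial_morphismI[OF subset_refl])
    fix y z assume yz: "y \<in> Y" "z \<in> Y"
    let ?m = "Suc (max (i y) (i z))"
    have m: "i y < ?m" "i z < ?m" by auto
    have mem: "y \<in> q ` {..<?m}" "z \<in> q ` {..<?m}"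
      using i[OF yz(1)] i[OF yz(2)] m by (metis imageI lessThan_iff)+
    show "l y z = d (h y) (h z)"
      unfolding h[OF yz(1) m(1)] h[OF yz(2) m(2)] by (rule partial_morphismD(3)[OF H mem])
  next
    fix y assume y: "y \<in> Y"
    have "y \<in> q ` {..<Suc (i y)}" using i[OF y] by (metis imageI lessI lessThan_iff)
    then show "h y \<in> M" unfolding h_def by (rule partial_morphismD(2)[OF H])
  qed
  then show ?thesis by blast
qed

text \<open>Let \<open>g x\<close> be the limit of the distances from \<open>x\<close> to the Cauchy sequence \<open>\<tau>\<close>. Unless \<open>g\<close> vanishes
  somewhere, \<open>\<tau>\<close> together with an ideal point at distances \<open>g\<close> is a metric space, and its finite
  subspaces are limits of finite subspaces of the given space. So it embeds, and an automorphism extending the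
  embedding of \<open>\<tau>\<close> pulls the image of the ideal point back to a limit of \<open>\<tau>\<close>.\<close>

lemma bounded_layers_closed_imp_mcomplete:
  assumes cl: "bounded_layers_closed (skeleton M d) r" and r: "0 < r"
  shows "mcomplete"
  unfolding mcomplete_def
proof (intro allI impI)
  let ?F = "skeleton M d"
  note F = finitary_structure_skeleton[OF is_gec] metric_skeleton[OF metric_gec]
  fix \<sigma> assume \<sigma>: "MCauchy \<sigma>"
  have \<sigma>M: "range \<sigma> \<subseteq> M"
    and \<sigma>C: "\<forall>\<epsilon>>0. \<exists>N. \<forall>n n'. N \<le> n \<longrightarrow> N \<le> n' \<longrightarrow> d (\<sigma> n) (\<sigma> n') < \<epsilon>"
    using \<sigma> unfolding MCauchy_def by (rule conjunct1, rule conjunct2)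
  obtain N where N: "\<And>i j. N \<le> i \<Longrightarrow> N \<le> j \<Longrightarrow> d (\<sigma> i) (\<sigma> j) < r"
    using \<sigma>C r by metis
  define \<tau> where "\<tau> i = \<sigma> (i + N)" for i
  have \<tau>M: "\<tau> i \<in> M" for i using \<sigma>M unfolding \<tau>_def by blast
  have small: "d (\<tau> i) (\<tau> j) \<le> r" for i j using N[of "i + N" "j + N"] unfolding \<tau>_def by simp
  have cauchy: "\<exists>K. \<forall>i\<ge>K. \<forall>j\<ge>K. d (\<tau> i) (\<tau> j) < \<epsilon>" if \<epsilon>: "0 < \<epsilon>" for \<epsilon>
  proof -
    obtain K where "\<And>i j. K \<le> i \<Longrightarrow> K \<le> j \<Longrightarrow> d (\<sigma> i) (\<sigma> j) < \<epsilon>"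
      using \<sigma>C \<epsilon> by metis
    then show ?thesis unfolding \<tau>_def by (intro exI[of _ K]) simp
  qed
  define g where "g x = lim (\<lambda>i. d x (\<tau> i))" for x
  have g: "(\<lambda>i. d x (\<tau> i)) \<longlonglongrightarrow> g x" if x: "x \<in> M" for x
  proof -
    have "Cauchy (\<lambda>i. d x (\<tau> i))"
    proof (rule metric_CauchyI)
      fix \<epsilon> :: real assume "0 < \<epsilon>"
      then obtain K where K: "\<forall>i\<ge>K. \<forall>j\<ge>K. d (\<tau> i) (\<tau> j) < \<epsilon>" using cauchy by blast
      have "dist (d x (\<tau> i)) (d x (\<tau> j)) < \<epsilon>" if "K \<le> i" "K \<le> j" for i j
      proof -
        have "\<bar>d x (\<tau> i) - d x (\<tau> j)\<bar> \<le> d (\<tau> i) (\<tau> j)"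
          using triangle[OF x \<tau>M \<tau>M, of i j] triangle[OF x \<tau>M \<tau>M, of j i]
            commute[of "\<tau> i" "\<tau> j"] by linarith
        also have "\<dots> < \<epsilon>" using K that by blast
        finally show ?thesis unfolding dist_real_def .
      qed
      then show "\<exists>K. \<forall>i\<ge>K. \<forall>j\<ge>K. dist (d x (\<tau> i)) (d x (\<tau> j)) < \<epsilon>" by blast
    qed
    then show ?thesis unfolding g_def by (metis Cauchy_convergent convergent_LIMSEQ_iff)
  qed
  have g0: "(\<lambda>i. g (\<tau> i)) \<longlonglongrightarrow> 0"
  proof (rule LIMSEQ_I)
    fix \<epsilon> :: real assume \<epsilon>: "0 < \<epsilon>"
    then obtain K where K: "\<forall>i\<ge>K. \<forall>j\<ge>K. d (\<tau> i) (\<tau> j) < \<epsilon> / 2" using cauchy[of "\<epsilon> / 2"] by auto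
    have "norm (g (\<tau> i) - 0) < \<epsilon>" if "K \<le> i" for i
    proof -
      have "g (\<tau> i) \<le> \<epsilon> / 2"
        by (rule LIMSEQ_le_const2[OF g[OF \<tau>M]]) (use K that less_imp_le in blast)
      moreover have "0 \<le> g (\<tau> i)"
        by (rule LIMSEQ_le_const[OF g[OF \<tau>M]]) simp
      ultimately show ?thesis using \<epsilon> by simp
    qed
    then show "\<exists>K. \<forall>i\<ge>K. norm (g (\<tau> i) - 0) < \<epsilon>" by blast
  qed
  have "\<exists>x\<in>M. (\<lambda>i. d (\<tau> i) x) \<longlonglongrightarrow> 0"
  proof (cases "\<exists>x\<in>M. g x = 0")
    case True
    then obtain x where "x \<in> M" "g x = 0" by blast
    then show ?thesis using g[of x] commute by auto
  next
    case False
    let ?S = "range \<tau>"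
    let ?Y = "insert None (Some ` ?S)"
    have SM: "?S \<subseteq> M" using \<tau>M by blast
    have "age_in ?F ?Y (adjoin d g)"
    proof (rule age_in_finite_character)
      fix T assume T: "T \<subseteq> ?Y" "finite T"
      define A where "A = Some -` T"
      have A: "finite A" "A \<subseteq> ?S" using T unfolding A_def by (auto simp: finite_vimageI)
      have AM: "A \<subseteq> M" using A(2) SM by blast
      let ?U = "insert None (Some ` A)"
      have "\<forall>\<^sub>F i in sequentially. \<forall>a\<in>A. 0 < d a (\<tau> i)"
      proof (rule eventually_ball_finite[OF A(1)], rule ballI)
        fix a assume "a \<in> A"
        then have a: "a \<in> M" using AM by blast
        have "0 \<le> g a" by (rule LIMSEQ_le_const[OF g[OF a]]) simp
        then have "0 < g a" using False a by force
        with g[OF a] show "\<forall>\<^sub>F i in sequentially. 0 < d a (\<tau> i)" by (rule order_tendstoD(1))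
      qed
      then obtain L where L: "\<And>i a. L \<le> i \<Longrightarrow> a \<in> A \<Longrightarrow> 0 < d a (\<tau> i)"
        unfolding eventually_sequentially by blast
      have "age_in ?F ?U (adjoin d g)"
      proof (rule age_in_limit_bounded[OF F cl])
        show "finite ?U" using A(1) by simp
        fix i :: nat
        let ?e = "\<lambda>p. case p of None \<Rightarrow> \<tau> (i + L) | Some x \<Rightarrow> x"
        let ?k = "adjoin d (\<lambda>x. d x (\<tau> (i + L)))"
        have pm: "partial_morphism ?U ?k M d ?U ?e"
          by (rule partial_morphismI) (use AM \<tau>M commute in \<open>auto simp: mdist_zero\<close>)
        have "\<tau> (i + L) \<notin> A" using L[of "i + L" "\<tau> (i + L)"] mdist_zero[OF \<tau>M] by auto
        then have inj: "inj_on ?e ?U" by (auto simp: inj_on_def)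
        show "age_in ?F ?U ?k"
          by (rule age_in_pullback[OF age_skeleton is_gec_pullback[OF is_gec pm inj] pm])
        fix p q assume p: "p \<in> ?U" and q: "q \<in> ?U"
        have small': "d a b \<le> r" if "a \<in> A" "b \<in> A" for a b
          using subsetD[OF A(2) that(1)] subsetD[OF A(2) that(2)] small by auto
        have small'': "d a (\<tau> (i + L)) \<le> r" if "a \<in> A" for a
          using subsetD[OF A(2) that] small by auto
        show "?k p q \<le> r" using p q small' small'' r by auto
      next
        fix p q assume p: "p \<in> ?U" and q: "q \<in> ?U"
        show "(\<lambda>i. adjoin d (\<lambda>x. d x (\<tau> (i + L))) p q) \<longlonglongrightarrow> adjoin d g p q"
          using p q AM LIMSEQ_ignore_initial_segment[OF g, of _ L] by auto
        assume "p \<noteq> q"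
        moreover have "d x y \<noteq> 0" if "x \<in> A" "y \<in> A" "x \<noteq> y" for x y
          using that zero[of x y] AM by blast
        ultimately show "adjoin d g p q \<noteq> 0" using p q AM False by (auto simp: subset_iff)
      qed
      then show "age_in ?F T (adjoin d g)"
        by (rule age_in_subset) (use T(1) in \<open>auto simp: A_def\<close>)
    qed
    moreover have "countable ?Y" by simp
    ultimately obtain h where h: "partial_morphism ?Y (adjoin d g) M d ?Y h"
      using countable_age_in_skeleton_embeds by blast
    have "partial_morphism M d M d ?S (\<lambda>x. h (Some x))"
    proof (rule partial_morphismI[OF SM])
      show "h (Some x) \<in> M" if "x \<in> ?S" for x by (rule partial_morphismD(2)[OF h]) (use that in blast)
      show "d x y = d (h (Some x)) (h (Some y))" if "x \<in> ?S" "y \<in> ?S" for x y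
        using partial_morphismD(3)[OF h, of "Some x" "Some y"] that by simp
    qed
    from extend_to_automorphism[OF this] obtain G where G: "automorphism G"
      and Gh: "\<And>x. x \<in> ?S \<Longrightarrow> G x = h (Some x)" by blast
    have "h None \<in> M" by (rule partial_morphismD(2)[OF h]) blast
    then obtain x where x: "x \<in> M" "G x = h None" using automorphismD(1)[OF G] by (metis imageE)
    have "d (\<tau> i) x = g (\<tau> i)" for i
    proof -
      have "d (\<tau> i) x = d (G (\<tau> i)) (G x)" by (rule automorphismD(4)[OF G \<tau>M x(1), symmetric])
      also have "\<dots> = d (h (Some (\<tau> i))) (h None)" using Gh[of "\<tau> i"] x(2) by simp
      also have "\<dots> = adjoin d g (Some (\<tau> i)) None"
        by (rule partial_morphismD(3)[OF h, symmetric]) blast+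
      finally show ?thesis by simp
    qed
    then have "(\<lambda>i. d (\<tau> i) x) = (\<lambda>i. g (\<tau> i))" by (rule ext)
    then have "(\<lambda>i. d (\<tau> i) x) \<longlonglongrightarrow> 0" using g0 by (simp only:)
    then show ?thesis using x(1) by (rule bexI)
  qed
  then obtain x where "x \<in> M" "(\<lambda>i. d (\<tau> i) x) \<longlonglongrightarrow> 0" by blast
  then have "limitin mtopology \<tau> x sequentially" unfolding limitin_metric_dist_null using \<tau>M by simp
  then show "\<exists>x. limitin mtopology \<sigma> x sequentially"
    unfolding \<tau>_def by (intro exI) (rule limitin_sequentially_offset_rev)
qed

end

section \<open>Connected components\<close>

context ab_ho_metric_space
begin

lemma automorphism_homeomorphic_map:
  assumes "automorphism g"
  shows "homeomorphic_map mtopology mtopology g"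
proof -
  interpret Metric_space12 M d M d by unfold_locales
  show ?thesis
    by (rule isometry_imp_homeomorphic_map) (use automorphismD[OF assms] in blast)+
qed

lemma automorphism_connected_image:
  assumes "automorphism g" "connectedin mtopology C"
  shows "connectedin mtopology (g ` C)"
  by (rule connectedin_continuous_map_image[OF
        homeomorphic_imp_continuous_map[OF automorphism_homeomorphic_map[OF assms(1)]] assms(2)])

lemma connected_attains_distances:
  assumes C: "connectedin mtopology C" and x: "x \<in> C" "y \<in> C" and t: "0 \<le> t" "t \<le> d x y"
  obtains z where "z \<in> C" "d x z = t"
proof -
  have CM: "C \<subseteq> M" using connectedin_subset_topspace[OF C] by simp
  have cont: "continuous_map mtopology euclideanreal (d x)"
    using continuous_on_mdist[of x "metric (M, d)"] x CM by auto
  have "connected (d x ` C)"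
    using connectedin_continuous_map_image[OF cont C] by simp
  moreover have "0 \<in> d x ` C" using x CM mdist_zero by force
  ultimately have "t \<in> d x ` C" using connectedD_interval[of "d x ` C" 0 "d x y" t] x t by blast
  then show thesis using that by blast
qed

text \<open>A connected set containing \<open>x\<close> and \<open>y\<close> meets all spheres around \<open>x\<close> of radius at most \<open>d x y\<close>. Its
  point at the same distance from \<open>x\<close> as \<open>z\<close> can be moved to \<open>z\<close> while \<open>x\<close> stays fixed.\<close>

lemma connected_copy:
  assumes C: "connectedin mtopology C" and x: "x \<in> C" "y \<in> C" and t: "d x z \<le> d x y" and z: "z \<in> M"
  obtains g where "automorphism g" "g x = x" "z \<in> g ` C"
proof -
  have CM: "C \<subseteq> M" using connectedin_subset_topspace[OF C] by simp
  obtain c where c: "c \<in> C" "d x c = d x z"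
    using connected_attains_distances[OF C x _ t] nonneg by blast
  obtain g where "automorphism g" "g x = x" "g c = z"
    using move_pair[of x c x z] c CM x(1) z by blast
  then show thesis using that c(1) by blast
qed

lemma connected_moved_into_ball:
  assumes C: "C \<subseteq> mball x \<epsilon>" "a \<in> C" and g: "automorphism g"
  shows "g ` C \<subseteq> mball (g a) (2 * \<epsilon>)"
proof
  fix y assume "y \<in> g ` C"
  then obtain c where c: "c \<in> C" "y = g c" by blast
  have M: "a \<in> M" "c \<in> M" "x \<in> M" and lt: "d x a < \<epsilon>" "d x c < \<epsilon>"
    using subsetD[OF C(1) C(2)] subsetD[OF C(1) c(1)] by auto
  have "d a c \<le> d a x + d x c" by (rule triangle[OF M(1,3,2)])
  then have "d a c < 2 * \<epsilon>" using lt commute[of a x] by linarith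
  then show "y \<in> mball (g a) (2 * \<epsilon>)"
    using automorphismD(3,4)[OF g] M c(2) by simp
qed

text \<open>If some ball contains no connected set with two points, then by homogeneity no ball of that radius
  does. Otherwise every point \<open>x\<close> lies in arbitrarily small connected sets with a second point, at a
  distance \<open>\<delta>\<close> say; copies of such a set that fix \<open>x\<close> connect \<open>x\<close> to every point closer than \<open>\<delta>\<close>.\<close>

theorem locally_connected_or_hereditary_disconnected:
  "locally_connected_space mtopology \<or> locally_hereditary_disconnected mtopology"
proof (cases "\<exists>\<epsilon>>0. \<exists>p\<in>M. \<forall>C a b. connectedin mtopology C \<and> C \<subseteq> mball p \<epsilon> \<and> a \<in> C \<and> b \<in> C \<longrightarrow> a = b")
  case True
  then obtain \<epsilon> p where \<epsilon>: "0 < \<epsilon>" and p: "p \<in> M"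
    and triv: "\<And>C a b. connectedin mtopology C \<Longrightarrow> C \<subseteq> mball p \<epsilon> \<Longrightarrow> a \<in> C \<Longrightarrow> b \<in> C \<Longrightarrow> a = b"
    by metis
  have "hereditary_disconnected (subtopology mtopology (mball x \<epsilon>))" if x: "x \<in> M" for x
    unfolding hereditary_disconnected_def
  proof
    fix C assume C: "C \<in> connected_components_of (subtopology mtopology (mball x \<epsilon>))"
    then have conn: "connectedin mtopology C" and sub: "C \<subseteq> mball x \<epsilon>"
      using connectedin_connected_components_of[OF C] unfolding connectedin_subtopology by blast+
    obtain a where a: "a \<in> C" using nonempty_connected_components_of[OF C] by blast
    obtain g where g: "automorphism g" "g x = p" using move_point[OF x p] by blast
    have "g ` C \<subseteq> mball p \<epsilon>"
    proof
      fix y assume "y \<in> g ` C"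
      then obtain c where c: "c \<in> C" "y = g c" by blast
      then have "c \<in> M" "d x c < \<epsilon>" using sub by auto
      then show "y \<in> mball p \<epsilon>"
        using automorphismD(3)[OF g(1)] automorphismD(4)[OF g(1) x] g(2) c(2) p by auto
    qed
    then have "g a = g b" if "b \<in> C" for b
      using triv[OF automorphism_connected_image[OF g(1) conn]] a that by blast
    moreover have "C \<subseteq> M" using sub by auto
    ultimately have "b = a" if "b \<in> C" for b
      using inj_onD[OF automorphismD(2)[OF g(1)]] a that by blast
    then show "\<exists>x. C = {x}" using a by blast
  qed
  then have "locally_hereditary_disconnected mtopology"
    unfolding locally_hereditary_disconnected_def
    by (intro exI[of _ "(\<lambda>x. mball x \<epsilon>) ` M"]) (use \<epsilon> in auto)
  then show ?thesis ..
next
  case False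
  have "locally_connected_space mtopology"
    unfolding locally_connected_space_im_kleinen
  proof (intro allI impI, elim conjE)
    fix V x assume V: "openin mtopology V" and xV: "x \<in> V"
    then have x: "x \<in> M" using openin_subset by fastforce
    obtain \<epsilon> where \<epsilon>: "0 < \<epsilon>" "mball x \<epsilon> \<subseteq> V" using V xV unfolding openin_mtopology by blast
    have "\<not> (\<forall>C a b. connectedin mtopology C \<and> C \<subseteq> mball x (\<epsilon> / 2) \<and> a \<in> C \<and> b \<in> C \<longrightarrow> a = b)"
      using False \<epsilon>(1) x by (metis half_gt_zero)
    then obtain C a b where C: "connectedin mtopology C" "C \<subseteq> mball x (\<epsilon> / 2)"
      and ab: "a \<in> C" "b \<in> C" "a \<noteq> b" by blast
    have abM: "a \<in> M" "b \<in> M" using C(2) ab by auto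
    obtain g where g: "automorphism g" "g a = x" using move_point[OF abM(1) x] by blast
    let ?C = "g ` C"
    have C': "connectedin mtopology ?C" by (rule automorphism_connected_image[OF g(1) C(1)])
    have ball: "?C \<subseteq> mball x \<epsilon>" using connected_moved_into_ball[OF C(2) ab(1) g(1)] g(2) by simp
    have xb: "x \<in> ?C" "g b \<in> ?C" using ab g(2) by auto
    have dab: "d x (g b) = d a b" using automorphismD(4)[OF g(1) abM] g(2) by simp
    let ?U = "mball x (d a b)"
    have "d a b < \<epsilon>" using ball xb(2) dab by auto
    then have UV: "?U \<subseteq> V" using \<epsilon>(2) mball_subset_concentric[of "d a b" \<epsilon> x] by auto
    have "\<exists>B. connectedin mtopology B \<and> B \<subseteq> V \<and> x \<in> B \<and> y \<in> B" if y: "y \<in> ?U" for y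
    proof -
      have "y \<in> M" "d x y \<le> d x (g b)" using y dab by auto
      then obtain h where h: "automorphism h" "h x = x" "y \<in> h ` ?C"
        using connected_copy[OF C' xb] by blast
      have "h ` ?C \<subseteq> mball x \<epsilon>"
      proof
        fix w assume "w \<in> h ` ?C"
        then obtain c where c: "c \<in> ?C" "w = h c" by blast
        then have "c \<in> M" "d x c < \<epsilon>" using ball by auto
        then show "w \<in> mball x \<epsilon>"
          using automorphismD(3)[OF h(1)] automorphismD(4)[OF h(1) x] h(2) c(2) x by auto
      qed
      moreover have "x \<in> h ` ?C" using h(2) xb(1) by force
      moreover have "connectedin mtopology (h ` ?C)" by (rule automorphism_connected_image[OF h(1) C'])
      ultimately show ?thesis using \<epsilon>(2) h(3) by blast
    qed
    moreover have "0 < d a b" using abM ab(3) by simp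
    then have "x \<in> ?U" using x by simp
    ultimately show "\<exists>U. openin mtopology U \<and> x \<in> U \<and> U \<subseteq> V \<and>
        (\<forall>y\<in>U. \<exists>B. connectedin mtopology B \<and> B \<subseteq> V \<and> x \<in> B \<and> y \<in> B)"
      using UV by (intro exI[of _ ?U]) auto
  qed
  then show ?thesis ..
qed

text \<open>An unbounded component containing \<open>x\<close> has copies that connect \<open>x\<close> to any given point.\<close>

theorem disconnected_imp_bounded_components:
  assumes disc: "\<not> connected_space mtopology" and C: "C \<in> connected_components_of mtopology"
  shows "mbounded C"
proof (rule ccontr)
  assume unb: "\<not> mbounded C"
  have conn: "connectedin mtopology C" by (rule connectedin_connected_components_of[OF C])
  have CM: "C \<subseteq> M" using connectedin_subset_topspace[OF conn] by simp
  obtain x where x: "x \<in> C" using nonempty_connected_components_of[OF C] by blast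
  have joined: "connected_component_of mtopology x z" if z: "z \<in> M" for z
  proof -
    obtain y where y: "y \<in> C" "d x z \<le> d x y"
    proof -
      have "\<not> C \<subseteq> mcball x (d x z)" using unb unfolding mbounded_def by blast
      then obtain y where "y \<in> C" "y \<notin> mcball x (d x z)" by blast
      then have "d x z \<le> d x y" using x CM by auto
      with \<open>y \<in> C\<close> show thesis by (rule that)
    qed
    obtain g where g: "automorphism g" "g x = x" "z \<in> g ` C"
      using connected_copy[OF conn x y(1) y(2) z] by blast
    have "x \<in> g ` C" using g(2) x by force
    then show ?thesis
      unfolding connected_component_of_def
      using automorphism_connected_image[OF g(1) conn] g(3) by blast
  qed
  have "connected_space mtopology"
    unfolding connected_space_iff_connected_component
  proof (intro ballI)
    fix y z assume "y \<in> topspace mtopology" "z \<in> topspace mtopology"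
    then have "connected_component_of mtopology x y" "connected_component_of mtopology x z"
      using joined by simp_all
    then show "connected_component_of mtopology y z"
      using connected_component_of_sym connected_component_of_trans by metis
  qed
  then show False using disc by blast
qed

text \<open>A non-empty partial isometry of \<open>C\<close> extends to an automorphism \<open>g\<close> of the whole space that maps some
  point of \<open>C\<close> into \<open>C\<close>; the hypothesis then lets \<open>g\<close> be restricted to \<open>C\<close>. The empty one extends to the
  identity.\<close>

lemma invariant_subset_ab_ho:
  assumes CM: "C \<subseteq> M"
    and inv: "\<And>g a. automorphism g \<Longrightarrow> a \<in> C \<Longrightarrow> g a \<in> C \<Longrightarrow> g ` C = C"
  shows "ab_ho C d"
  unfolding ab_ho_def
proof (intro conjI allI impI)
  show "is_gec C d" by (rule is_gec_subset[OF is_gec CM])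
  fix A f assume f: "partial_morphism C d C d A f"
  have "\<exists>g. automorphism g \<and> g ` C = C \<and> (\<forall>a\<in>A. g a = f a)"
  proof (cases "A = {}")
    case True
    have "automorphism (\<lambda>x. x)"
      unfolding automorphism_def gec_iso_def partial_morphism_def by (simp add: bij_betw_def)
    then show ?thesis using True by (intro exI[of _ "\<lambda>x. x"]) simp
  next
    case False
    then obtain a where a: "a \<in> A" by blast
    have "partial_morphism M d M d A f"
    proof (rule partial_morphismI)
      show "A \<subseteq> M" using partial_morphismD(1)[OF f] CM by blast
      show "f a \<in> M" if "a \<in> A" for a using partial_morphismD(2)[OF f that] CM by blast
    qed (rule partial_morphismD(3)[OF f])
    from extend_to_automorphism[OF this] obtain g
      where g: "automorphism g" "\<And>a. a \<in> A \<Longrightarrow> g a = f a" by blast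
    have "g a \<in> C" unfolding g(2)[OF a] by (rule partial_morphismD(2)[OF f a])
    from inv[OF g(1) partial_morphismD(1)[OF f a] this] show ?thesis using g by (intro exI[of _ g]) simp
  qed
  then obtain g where g: "automorphism g" "g ` C = C" "\<And>a. a \<in> A \<Longrightarrow> g a = f a" by metis
  have "partial_morphism C d C d C g"
  proof (rule partial_morphismI[OF subset_refl])
    show "g a \<in> C" if "a \<in> C" for a using g(2) that by blast
    show "d a b = d (g a) (g b)" if "a \<in> C" "b \<in> C" for a b
      using automorphismD(4)[OF g(1), of a b] CM that by (metis subsetD)
  qed
  moreover have "bij_betw g C C"
    unfolding bij_betw_def using g(2) inj_on_subset[OF automorphismD(2)[OF g(1)] CM] by blast
  ultimately have "gec_iso C d C d g" unfolding gec_iso_def by (rule conjI)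
  then show "\<exists>g. gec_iso C d C d g \<and> (\<forall>a\<in>A. g a = f a)" using g(3) by (intro exI[of _ g]) simp
qed

theorem connected_component_ab_ho:
  assumes C: "C \<in> connected_components_of mtopology"
  shows "ab_ho C d"
proof (rule invariant_subset_ab_ho)
  show CM: "C \<subseteq> M" using connected_components_of_subset[OF C] by simp
  fix g a assume g: "automorphism g" and a: "a \<in> C" "g a \<in> C"
  have comp: "C = connected_component_of_set mtopology x" if x: "x \<in> C" for x
  proof -
    obtain y where "C = connected_component_of_set mtopology y"
      using C unfolding connected_components_of_def by blast
    then show ?thesis using connected_component_of_equiv[of mtopology y x] x by auto
  qed
  have "connected_component_of_set mtopology (g a) = g ` connected_component_of_set mtopology a"
    by (rule homeomorphic_map_connected_component_of[OF automorphism_homeomorphic_map[OF g]])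
      (use a CM in auto)
  then show "g ` C = C" using comp[OF a(1)] comp[OF a(2)] by simp
qed

end

section \<open>Arcs\<close>

lemma arc_joined_iff_inj:
  assumes H: "Hausdorff_space T"
  shows "arc_joined T x y \<longleftrightarrow>
    (\<exists>g. continuous_map (top_of_set {0..1::real}) T g \<and> inj_on g {0..1} \<and> g 0 = x \<and> g 1 = y)"
proof -
  have "embedding_map (top_of_set {0..1::real}) T g \<longleftrightarrow>
      continuous_map (top_of_set {0..1}) T g \<and> inj_on g {0..1}" for g
  proof
    assume e: "embedding_map (top_of_set {0..1::real}) T g"
    then have h: "homeomorphic_map (top_of_set {0..1}) (subtopology T (g ` {0..1})) g"
      unfolding embedding_map_def by simp
    then have "continuous_map (top_of_set {0..1}) T g"
      using homeomorphic_imp_continuous_map continuous_map_into_fulltopology by blast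
    moreover have "inj_on g {0..1}" using homeomorphic_imp_injective_map[OF h] by simp
    ultimately show "continuous_map (top_of_set {0..1}) T g \<and> inj_on g {0..1}" ..
  next
    assume "continuous_map (top_of_set {0..1}) T g \<and> inj_on g {0..1}"
    then show "embedding_map (top_of_set {0..1::real}) T g"
      by (intro continuous_imp_embedding_map[OF _ _ H]) (auto simp: compact_space_subtopology)
  qed
  then show ?thesis unfolding arc_joined_def by blast
qed

lemma arc_joinedI:
  fixes a b :: real
  assumes H: "Hausdorff_space T" and ab: "a < b"
    and g: "continuous_map (top_of_set {a..b}) T g" "inj_on g {a..b}"
  shows "arc_joined T (g a) (g b)"
proof -
  let ?p = "\<lambda>u. a + (b - a) * u"
  have "?p u \<in> {a..b}" if "u \<in> {0..1}" for u
  proof -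
    have "0 \<le> (b - a) * u" "(b - a) * u \<le> b - a" using that ab by (simp_all add: mult_left_le)
    then show ?thesis unfolding atLeastAtMost_iff by linarith
  qed
  then have p: "?p \<in> {0..1} \<rightarrow> {a..b}" by blast
  have "continuous_map (top_of_set {0..1}) (top_of_set {a..b}) ?p"
    using p by (intro continuous_map_into_subtopology) (auto intro!: continuous_intros)
  then have "continuous_map (top_of_set {0..1}) T (g \<circ> ?p)" using g(1) by (rule continuous_map_compose)
  moreover have "inj_on (g \<circ> ?p) {0..1}"
  proof (rule comp_inj_on)
    show "inj_on ?p {0..1}" using ab by (auto simp: inj_on_def)
    show "inj_on g (?p ` {0..1})" using g(2) by (rule inj_on_subset) (use p in blast)
  qed
  ultimately show ?thesis
    unfolding arc_joined_iff_inj[OF H] by (intro exI[of _ "g \<circ> ?p"]) simp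
qed

lemma arc_joined_sym:
  assumes H: "Hausdorff_space T" and "arc_joined T x y"
  shows "arc_joined T y x"
proof -
  obtain g where g: "continuous_map (top_of_set {0..1::real}) T g" "inj_on g {0..1}" "g 0 = x" "g 1 = y"
    using assms(2) unfolding arc_joined_iff_inj[OF H] by blast
  have "continuous_map (top_of_set {0..1}) (top_of_set {0..1}) (\<lambda>u::real. 1 - u)"
    by (intro continuous_map_into_subtopology) (auto intro!: continuous_intros)
  then have "continuous_map (top_of_set {0..1}) T (g \<circ> (\<lambda>u. 1 - u))"
    using g(1) by (rule continuous_map_compose)
  moreover have "inj_on (g \<circ> (\<lambda>u. 1 - u)) {0..1}"
  proof (rule comp_inj_on)
    show "inj_on g ((\<lambda>u. 1 - u) ` {0..1})" by (rule inj_on_subset[OF g(2)]) auto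
  qed (auto simp: inj_on_def)
  ultimately show ?thesis
    unfolding arc_joined_iff_inj[OF H] using g(3,4) by (intro exI[of _ "g \<circ> (\<lambda>u. 1 - u)"]) simp
qed

text \<open>Follow the first arc \<open>g\<close> up to its first point on the second arc \<open>h\<close>, and \<open>h\<close> from there on. The two
  pieces meet only at the point \<open>g s = h t\<close>, and they do not both degenerate because \<open>x \<noteq> z\<close>.\<close>

lemma arc_joined_trans:
  assumes H: "Hausdorff_space T" and xy: "arc_joined T x y" and yz: "arc_joined T y z" and ne: "x \<noteq> z"
  shows "arc_joined T x z"
proof -
  obtain g where g: "continuous_map (top_of_set {0..1::real}) T g" "inj_on g {0..1}" "g 0 = x" "g 1 = y"
    using xy unfolding arc_joined_iff_inj[OF H] by blast
  obtain h where h: "continuous_map (top_of_set {0..1::real}) T h" "inj_on h {0..1}" "h 0 = y" "h 1 = z"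
    using yz unfolding arc_joined_iff_inj[OF H] by blast
  let ?B = "h ` {0..1}"
  have "compactin T ?B" by (rule image_compactin[OF _ h(1)]) (auto simp: compactin_subtopology)
  then have "closedin T ?B" using H by (rule compactin_imp_closedin[rotated])
  from closedin_continuous_map_preimage[OF g(1) this]
  have "closedin (top_of_set {0..1}) {u \<in> {0..1}. g u \<in> ?B}" by simp
  then have "compact {u \<in> {0..1::real}. g u \<in> ?B}"
    using closedin_compact compact_Icc by blast
  moreover have "1 \<in> {u \<in> {0..1}. g u \<in> ?B}" using g(4) h(3) by force
  ultimately obtain s where s: "s \<in> {0..1}" "g s \<in> ?B" and first: "\<And>u. u \<in> {0..1} \<Longrightarrow> g u \<in> ?B \<Longrightarrow> s \<le> u"
    using compact_attains_inf[of "{u \<in> {0..1}. g u \<in> ?B}"] by blast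
  obtain t where t: "t \<in> {0..1}" "g s = h t" using s(2) by blast
  define e where "e = s + (1 - t)"
  define k where "k u = (if u \<le> s then g u else h (t + (u - s)))" for u
  have "0 < e"
  proof (rule ccontr)
    assume "\<not> 0 < e"
    then have "s = 0" "t = 1" using s(1) t(1) unfolding e_def by auto
    then show False using t(2) g(3) h(4) ne by simp
  qed
  have cont: "continuous_map (top_of_set {0..e}) T k"
    unfolding k_def
  proof (rule continuous_map_cases_le)
    show "continuous_map (top_of_set {0..e}) euclideanreal (\<lambda>u. u)"
      "continuous_map (top_of_set {0..e}) euclideanreal (\<lambda>u. s)" by (auto intro!: continuous_intros)
    have "{0..e} \<inter> {u \<in> topspace (top_of_set {0..e}). u \<le> s} \<subseteq> {0..1}" using s(1) by auto
    then show "continuous_map (subtopology (top_of_set {0..e}) {u \<in> topspace (top_of_set {0..e}). u \<le> s}) T g"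
      unfolding subtopology_subtopology by (rule continuous_map_from_subtopology_mono[OF g(1)])
    let ?R = "{0..e} \<inter> {u \<in> topspace (top_of_set {0..e}). s \<le> u}"
    have "continuous_map (top_of_set ?R) (top_of_set {0..1}) (\<lambda>u. t + (u - s))"
      by (intro continuous_map_into_subtopology)
        (use s(1) t(1) in \<open>auto intro!: continuous_intros simp: e_def\<close>)
    from continuous_map_compose[OF this h(1)]
    show "continuous_map (subtopology (top_of_set {0..e}) {u \<in> topspace (top_of_set {0..e}). s \<le> u}) T
        (\<lambda>u. h (t + (u - s)))"
      unfolding subtopology_subtopology by (simp add: o_def)
    show "g u = h (t + (u - s))" if "u = s" for u using that t(2) by simp
  qed
  have cross: "g u \<noteq> h (t + (v - s))" if "0 \<le> u" "u \<le> s" "s < v" "v \<le> e" for u v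
  proof
    assume eq: "g u = h (t + (v - s))"
    have u: "u \<in> {0..1}" and v: "t + (v - s) \<in> {0..1}" using that s(1) t(1) unfolding e_def by auto
    then have "g u \<in> ?B" using eq by blast
    from first[OF u this] have "u = s" using that(2) by simp
    then have "t = t + (v - s)" using inj_onD[OF h(2) _ t(1) v] eq t(2) by simp
    then show False using that(3) by simp
  qed
  have "inj_on k {0..e}"
  proof (rule linorder_inj_onI)
    fix u v assume uv: "u < v" "u \<in> {0..e}" "v \<in> {0..e}"
    consider "v \<le> s" | "u \<le> s" "s < v" | "s < u" using uv by linarith
    then show "k u \<noteq> k v"
    proof cases
      case 1
      then show ?thesis using uv s(1) inj_onD[OF g(2), of u v] unfolding k_def by auto
    next
      case 2
      then show ?thesis using cross[of u v] uv unfolding k_def by auto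
    next
      case 3
      have "t + (u - s) \<in> {0..1}" "t + (v - s) \<in> {0..1}"
        using 3 uv t(1) unfolding e_def by auto
      then show ?thesis using 3 uv inj_onD[OF h(2), of "t + (u - s)" "t + (v - s)"] unfolding k_def by auto
    qed
  qed auto
  from arc_joinedI[OF H \<open>0 < e\<close> cont this] have "arc_joined T (k 0) (k e)" .
  moreover have "k 0 = x" using s(1) g(3) unfolding k_def by simp
  moreover have "k e = z"
  proof (cases "t = 1")
    case True
    then show ?thesis using t(2) h(4) unfolding k_def e_def by simp
  next
    case False
    then show ?thesis using t(1) h(4) unfolding k_def e_def by simp
  qed
  ultimately show ?thesis by simp
qed

context ab_ho_metric_space
begin

lemma automorphism_arc_joined:
  assumes g: "automorphism g" and xy: "arc_joined mtopology x y"
  shows "arc_joined mtopology (g x) (g y)"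
proof -
  note iff = arc_joined_iff_inj[OF Hausdorff_space_mtopology]
  obtain c where c: "continuous_map (top_of_set {0..1::real}) mtopology c" "inj_on c {0..1}" "c 0 = x" "c 1 = y"
    using xy unfolding iff by blast
  have "continuous_map (top_of_set {0..1}) mtopology (g \<circ> c)"
    by (rule continuous_map_compose[OF c(1)
          homeomorphic_imp_continuous_map[OF automorphism_homeomorphic_map[OF g]]])
  moreover have "c ` {0..1} \<subseteq> M" using continuous_map_image_subset_topspace[OF c(1)] by simp
  then have "inj_on (g \<circ> c) {0..1}"
    by (intro comp_inj_on[OF c(2)] inj_on_subset[OF automorphismD(2)[OF g]])
  ultimately show ?thesis unfolding iff using c(3,4) by (intro exI[of _ "g \<circ> c"]) simp
qed

theorem arc_component_ab_ho:
  assumes C: "C \<in> arc_components_of mtopology"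
  shows "ab_ho C d"
proof -
  let ?R = "\<lambda>x y. y = x \<or> arc_joined mtopology x y"
  have sym: "?R y x" if "?R x y" for x y
    using that arc_joined_sym[OF Hausdorff_space_mtopology] by blast
  have trans: "?R x z" if "?R x y" "?R y z" for x y z
    using that arc_joined_trans[OF Hausdorff_space_mtopology, of x y z] by blast
  obtain p where p: "p \<in> M" "C = {y \<in> M. ?R p y}" using C unfolding arc_components_of_def by auto
  have fwd: "g w \<in> C" if g: "automorphism g" and a: "a \<in> C" "g a \<in> C" and w: "w \<in> C" for g a w
  proof -
    have "?R p a" "?R p w" using a(1) w unfolding p(2) by blast+
    then have "?R a w" using sym trans by metis
    then have "?R (g a) (g w)" using automorphism_arc_joined[OF g] by blast
    then have "?R p (g w)" using a(2) trans unfolding p(2) by blast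
    then show ?thesis using automorphismD(3)[OF g] w unfolding p(2) by blast
  qed
  show ?thesis
  proof (rule invariant_subset_ab_ho)
    show CM: "C \<subseteq> M" unfolding p(2) by blast
    fix g a assume g: "automorphism g" and a: "a \<in> C" "g a \<in> C"
    let ?i = "inv_into M g"
    have ia: "?i (g a) = a" using automorphismD(2)[OF g] a(1) CM by (simp add: subsetD)
    show "g ` C = C"
    proof
      show "g ` C \<subseteq> C" using fwd[OF g a] by blast
      show "C \<subseteq> g ` C"
      proof
        fix w assume w: "w \<in> C"
        have "?i w \<in> C" by (rule fwd[OF automorphism_inv[OF g] a(2) _ w]) (use ia a(1) in simp)
        moreover have "g (?i w) = w"
          by (rule f_inv_into_f) (use automorphismD(1)[OF g] w CM in blast)
        ultimately show "w \<in> g ` C" by (metis imageI)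
      qed
    qed
  qed
qed

end

section \<open>Skeletons, completeness and connectedness\<close>

theorem proposition3p31:
  fixes X :: "'a set" and \<rho> :: "'a \<Rightarrow> 'a \<Rightarrow> real"
  assumes "Metric_space X \<rho>" and "ab_ho X \<rho>"
  shows
    \<comment> \<open>(A)\<close>
    "(\<forall>F. metric_skeletoid F \<and> layer_closed F \<longrightarrow> edge_closed F \<and> is_skeleton F) \<and>
    \<comment> \<open>(B)\<close>
     (heine_borel X \<rho> \<longrightarrow> layer_closed (skeleton X \<rho>)) \<and>
     (\<forall>r>0. (\<forall>x\<in>X. compactin (Metric_space.mtopology X \<rho>) (Metric_space.mcball X \<rho> x r)) \<longrightarrow>
        (\<forall>n>0. closedin (top_of_set (metrics_on n)) (bounded_metrics_in (skeleton X \<rho>) r n))) \<and>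
    \<comment> \<open>(C)\<close>
     (layer_closed (skeleton X \<rho>) \<longrightarrow> Metric_space.mcomplete X \<rho>) \<and>
     (\<forall>r>0. (\<forall>n>0. closedin (top_of_set (metrics_on n)) (bounded_metrics_in (skeleton X \<rho>) r n)) \<longrightarrow>
        Metric_space.mcomplete X \<rho>) \<and>
    \<comment> \<open>(D)\<close>
     (locally_connected_space (Metric_space.mtopology X \<rho>) \<or>
      locally_hereditary_disconnected (Metric_space.mtopology X \<rho>)) \<and>
     (\<not> connected_space (Metric_space.mtopology X \<rho>) \<longrightarrow>
        (\<forall>C\<in>connected_components_of (Metric_space.mtopology X \<rho>). Metric_space.mbounded X \<rho> C)) \<and>
    \<comment> \<open>(E)\<close>
     (\<forall>C\<in>connected_components_of (Metric_space.mtopology X \<rho>). ab_ho C \<rho>) \<and>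
     (\<forall>C\<in>arc_components_of (Metric_space.mtopology X \<rho>). ab_ho C \<rho>)"
proof -
  interpret ab_ho_metric_space X \<rho>
    using assms by (simp add: ab_ho_metric_space_def ab_ho_metric_space_axioms_def)
  let ?F = "skeleton X \<rho>"
  have A: "edge_closed F \<and> is_skeleton F" if "metric_skeletoid F \<and> layer_closed F" for F
    using layer_closed_skeletoid_edge_closed layer_closed_skeletoid_is_skeleton that by blast
  have B: "bounded_layers_closed ?F r" if "\<forall>x\<in>X. compactin mtopology (mcball x r)" for r
    using compact_balls_bounded_layers_closed that by blast
  have B': "layer_closed ?F" if "heine_borel X \<rho>"
    using B that unfolding heine_borel_def layer_closed_iff_bounded by blast
  have C: mcomplete if "0 < r" "bounded_layers_closed ?F r" for r
    using bounded_layers_closed_imp_mcomplete that by blast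
  have C': mcomplete if "layer_closed ?F"
    using C[of 1] that unfolding layer_closed_iff_bounded by simp
  show ?thesis
    using A B B' C C' locally_connected_or_hereditary_disconnected disconnected_imp_bounded_components
      connected_component_ab_ho arc_component_ab_ho
    unfolding bounded_layers_closed_def by (intro conjI allI impI ballI) simp_all
qed

end
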